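(* Let $G\in\mathbb{R}^{n\times n}$ be a normalized positive semi-definite kernel matrix with largest eigenvalue $\lambda_{\max}$ and smallest eigenvalue $\lambda_{\min}$, and put $\kappa=\lambda_{\max}/\lambda_{\min}$ if $\lambda_{\min}>0$. Let $\alpha>0$ be a non-integer real number, and let $\epsilon\in(0,1/3)$, $\delta\in(0,1)$. Let $s=\lceil 8\ln(2/\delta)/\epsilon^2\rceil$ and $$m=\begin{cases}\left\lceil\alpha+\sqrt\kappa\left(\frac{\Gamma(\alpha+\frac12)\Gamma(\alpha)}{\epsilon\,\pi^{3/2}}\right)^{\frac1{2\alpha}}\right\rceil&\text{if }\lambda_{\min}>0,\\[2mm]\left\lceil\alpha+\left(\frac{n\,\Gamma(\alpha+\frac12)\Gamma(\alpha)}{\epsilon\,\pi^{3/2}}\right)^{\frac1{2\alpha}}\right\rceil&\text{if }\lambda_{\min}=0.\end{cases}$$ Let $\mathbf g_1,\dots,\mathbf g_s\in\mathbb{R}^n$ be i.i.d. standard Gaussian random vectors and set $$\tilde{\mathbf S}_\alpha(G)=\frac1{1-\alpha}\log_2\Big(\frac1s\sum_{i=1}^s\mathbf g_i^\top f_m(G)\,\mathbf g_i\Big),$$ where $f_m$ is the degree-$m$ Chebyshev polynomial approximation of $x\mapsto x^\alpha$ on $[0,\lambda_{\max}]$ given by $$f_m(x)=\frac{c_0}{2}T_0(x)+\sum_{k=1}^m c_kT_k(x),\quad T_k(x)=\cos\big(k\arccos(2x/\lambda_{\max}-1)\big),\quad c_k=\frac{2\lambda_{\max}^\alpha\,\Gamma(\alpha+\frac12)\,(\alpha)_k}{\sqrt\pi\,\Gamma(\alpha+1)\,(\alpha+k)_k}.$$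 Then with probability at least $1-\delta$ (the argument of the logarithm is positive and) $$\big|\mathbf S_\alpha(G)-\tilde{\mathbf S}_\alpha(G)\big|\le\Big|\frac1{1-\alpha}\log_2(1-3\epsilon)\Big|.$$
   Context: A normalized PSD kernel matrix is a matrix $G\in\mathbb{R}^{n\times n}$ of the form $G_{ij}=\frac1n\frac{K_{ij}}{\sqrt{K_{ii}K_{jj}}}$, where $K_{ij}=\varphi(x_i,x_j)$ for samples $x_1,\dots,x_n\in\mathcal X$ and a real-valued positive (semi-definite) infinitely divisible kernel $\varphi:\mathcal X\times\mathcal X\to\mathbb{R}$ with $\varphi(x_i,x_i)>0$. In particular $G$ is symmetric positive semi-definite with all diagonal entries $1/n$, so its trace is $1$. A positive kernel $\varphi$ is infinitely divisible if for every positive integer $p$ there is a positive kernel whose $p$-th power is $\varphi$. The matrix-based Rényi entropy of order $\alpha>0$, $\alpha\neq1$, is $\mathbf S_\alpha(G)=\frac{1}{1-\alpha}\log_2(\mathrm{tr}(G^\alpha))=\frac{1}{1-\alpha}\log_2\big(\sum_{i=1}^n\lambda_i^\alpha(G)\big)$, where $\lambda_i(G)$ are the eigenvalues of $G$. $(a)_k=a(a-1)\cdots(a-k+1)$ denotes the falling factorial (with $(a)_0=1$), $\Gamma$ is the gamma function, and $f_m(G)$ is the polynomial $f_m$ evaluated at the matrix $G$. The value $\lambda_{\max}$ used in the estimator is taken to be the exact largest eigenvalue. *)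

theory Defs
  imports "HOL-Probability.Probability" "HOL-Computational_Algebra.Polynomial"
begin

text \<open>Kernels are real-valued, and the \<open>p\<close>-th roots of an infinitely divisible kernel are
  real-valued kernels as well.\<close>

definition positive_kernel :: "('x \<Rightarrow> 'x \<Rightarrow> real) \<Rightarrow> bool" where
  "positive_kernel \<phi> \<longleftrightarrow>
     (\<forall>x y. \<phi> x y = \<phi> y x) \<and>
     (\<forall>N (x :: nat \<Rightarrow> 'x) (c :: nat \<Rightarrow> real). 0 \<le> (\<Sum>i<N. \<Sum>j<N. c i * c j * \<phi> (x i) (x j)))"

definition infinitely_divisible_kernel :: "('x \<Rightarrow> 'x \<Rightarrow> real) \<Rightarrow> bool" where
  "infinitely_divisible_kernel \<phi> \<longleftrightarrow>
     positive_kernel \<phi> \<and>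
     (\<forall>p::nat. p > 0 \<longrightarrow> (\<exists>\<psi>. positive_kernel \<psi> \<and> (\<forall>x y. \<psi> x y ^ p = \<phi> x y)))"

definition normalized_kernel_matrix :: "('x \<Rightarrow> 'x \<Rightarrow> real) \<Rightarrow> ('n::finite \<Rightarrow> 'x) \<Rightarrow> real^'n^'n" where
  "normalized_kernel_matrix \<phi> x =
     (\<chi> i j. 1 / real CARD('n) * (\<phi> (x i) (x j) / sqrt (\<phi> (x i) (x i) * \<phi> (x j) (x j))))"

definition charpoly :: "real^'n^'n \<Rightarrow> real poly" where
  "charpoly A = det (\<chi> i j. if i = j then [:- (A $ i $ j), 1:] else [:- (A $ i $ j):])"

text \<open>The real eigenvalues, repeated according to algebraic multiplicity. For a symmetric matrix
  these are all its eigenvalues, so that there are \<open>CARD('n)\<close> of them.\<close>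

definition eigenvalues :: "real^'n^'n \<Rightarrow> real multiset" where
  "eigenvalues A = proots (charpoly A)"

lemma poly_charpoly: "poly (charpoly A) t = det (mat t - A)"
  unfolding charpoly_def det_def poly_sum poly_mult poly_prod
  by (intro sum.cong prod.cong refl arg_cong2[where f = "(*)"])
     (auto simp: mat_def sign_def)

lemma poly_charpoly_eq_0_iff:
  "poly (charpoly A) t = 0 \<longleftrightarrow> (\<exists>v. v \<noteq> 0 \<and> A *v v = t *s v)"
proof -
  have mv: "mat t *v v = t *s v" for v :: "real^'a"
    by (simp add: vec_eq_iff matrix_vector_mult_def mat_def if_distrib [of "\<lambda>x. x * _"] cong: if_cong)
  have "poly (charpoly A) t = 0 \<longleftrightarrow> \<not> invertible (mat t - A)"
    by (simp add: poly_charpoly invertible_det_nz)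
  also have "\<dots> \<longleftrightarrow> (\<exists>v. v \<noteq> 0 \<and> (mat t - A) *v v = 0)"
    by (metis invertible_left_inverse matrix_left_invertible_ker)
  also have "\<dots> \<longleftrightarrow> (\<exists>v. v \<noteq> 0 \<and> A *v v = t *s v)"
    by (auto simp: matrix_vector_mult_diff_rdistrib mv)
  finally show ?thesis .
qed

lemma charpoly_nonzero: "charpoly A \<noteq> 0"
proof
  assume "charpoly A = 0"
  define K where "K = onorm ((*v) A)"
  have bl: "bounded_linear ((*v) A)"
    by (simp add: linear_conv_bounded_linear[symmetric])
  have "K \<ge> 0"
    unfolding K_def using bl by (rule onorm_pos_le)
  have "poly (charpoly A) (K + 1) = 0"
    using \<open>charpoly A = 0\<close> by simp
  then obtain v where v: "v \<noteq> 0" "A *v v = (K + 1) *s v"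
    by (auto simp: poly_charpoly_eq_0_iff)
  have "norm (A *v v) \<le> K * norm v"
    unfolding K_def using bl by (rule onorm)
  also have "norm (A *v v) = (K + 1) * norm v"
    using \<open>K \<ge> 0\<close> by (simp add: v scalar_mult_eq_scaleR)
  finally show False
    using v by (simp add: algebra_simps)
qed

lemma in_eigenvalues_iff: "t \<in># eigenvalues A \<longleftrightarrow> (\<exists>v. v \<noteq> 0 \<and> A *v v = t *s v)"
  by (simp add: eigenvalues_def charpoly_nonzero poly_charpoly_eq_0_iff)

definition lambda_max :: "real^'n^'n \<Rightarrow> real" where
  "lambda_max A = Max (set_mset (eigenvalues A))"

definition lambda_min :: "real^'n^'n \<Rightarrow> real" where
  "lambda_min A = Min (set_mset (eigenvalues A))"

text \<open>Note that \<open>0 powr \<alpha> = 0\<close>, which is the intended value for \<open>\<alpha> > 0\<close>.\<close>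

definition renyi_entropy :: "real \<Rightarrow> real^'n^'n \<Rightarrow> real" where
  "renyi_entropy \<alpha> A = 1 / (1 - \<alpha>) * log 2 (\<Sum>t\<in>#eigenvalues A. t powr \<alpha>)"

definition falling_factorial :: "real \<Rightarrow> nat \<Rightarrow> real" where
  "falling_factorial a k = (\<Prod>i<k. a - real i)"

definition cheb_coeff :: "real \<Rightarrow> real \<Rightarrow> nat \<Rightarrow> real" where
  "cheb_coeff \<alpha> L k =
     2 * L powr \<alpha> * Gamma (\<alpha> + 1/2) * falling_factorial \<alpha> k /
     (sqrt pi * Gamma (\<alpha> + 1) * falling_factorial (\<alpha> + real k) k)"

definition cheb_T :: "real \<Rightarrow> nat \<Rightarrow> real \<Rightarrow> real" where
  "cheb_T L k x = cos (real k * arccos (2 * x / L - 1))"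

definition cheb_approx :: "real \<Rightarrow> real \<Rightarrow> nat \<Rightarrow> real \<Rightarrow> real" where
  "cheb_approx \<alpha> L m x =
     cheb_coeff \<alpha> L 0 / 2 * cheb_T L 0 x + (\<Sum>k=1..m. cheb_coeff \<alpha> L k * cheb_T L k x)"

text \<open>The function \<open>cheb_T L k\<close> is a polynomial only on \<open>{0..L}\<close>, so evaluation at a matrix
  refers to the unique polynomial that agrees with \<open>cheb_approx\<close> on that interval.\<close>

definition cheb_approx_poly :: "real \<Rightarrow> real \<Rightarrow> nat \<Rightarrow> real poly" where
  "cheb_approx_poly \<alpha> L m = (THE p. \<forall>x\<in>{0..L}. poly p x = cheb_approx \<alpha> L m x)"

lemma ex_cheb_T_poly:
  assumes "L > 0"
  shows "\<exists>p. \<forall>x\<in>{0..L}. poly p x = cheb_T L k x"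
proof (induction k rule: induct_nat_012)
  case 0
  show ?case by (rule exI[of _ 1]) (simp add: cheb_T_def)
next
  case 1
  show ?case
    by (rule exI[of _ "[:-1, 2 / L:]"]) (use assms in \<open>auto simp: cheb_T_def field_simps\<close>)
next
  case (ge2 k)
  then obtain p q where p: "\<forall>x\<in>{0..L}. poly p x = cheb_T L k x"
    and q: "\<forall>x\<in>{0..L}. poly q x = cheb_T L (Suc k) x" by blast
  have rec: "cheb_T L (Suc (Suc k)) x = 2 * (2 * x / L - 1) * cheb_T L (Suc k) x - cheb_T L k x"
    if "x \<in> {0..L}" for x
  proof -
    define u where "u = arccos (2 * x / L - 1)"
    have cu: "cos u = 2 * x / L - 1"
      unfolding u_def using that assms by (intro cos_arccos) (auto simp: field_simps)
    have "cos (real (Suc k) * u + u) + cos (real (Suc k) * u - u) = 2 * cos u * cos (real (Suc k) * u)"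
      by (simp add: cos_add cos_diff)
    moreover have "real (Suc k) * u + u = real (Suc (Suc k)) * u" "real (Suc k) * u - u = real k * u"
      by (simp_all add: algebra_simps)
    ultimately show ?thesis
      unfolding cheb_T_def u_def[symmetric] by (simp add: cu)
  qed
  show ?case
    by (rule exI[of _ "smult 2 [:-1, 2 / L:] * q - p"])
       (use p q rec in \<open>auto simp: algebra_simps\<close>)
qed

lemma cheb_approx_poly_ex1:
  assumes "L > 0"
  shows "\<exists>!p. \<forall>x\<in>{0..L}. poly p x = cheb_approx \<alpha> L m x"
proof -
  obtain P where P: "\<And>k. \<forall>x\<in>{0..L}. poly (P k) x = cheb_T L k x"
    using ex_cheb_T_poly[OF assms] by metis
  define p where "p = smult (cheb_coeff \<alpha> L 0 / 2) (P 0) + (\<Sum>k=1..m. smult (cheb_coeff \<alpha> L k) (P k))"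
  show ?thesis
  proof (rule ex1I[of _ p])
    show p: "\<forall>x\<in>{0..L}. poly p x = cheb_approx \<alpha> L m x"
      by (simp add: p_def cheb_approx_def poly_sum P)
    fix q assume q: "\<forall>x\<in>{0..L}. poly q x = cheb_approx \<alpha> L m x"
    have "infinite {0..L}"
      using assms by simp
    moreover have "{0..L} \<subseteq> {x. poly (q - p) x = 0}"
      using p q by auto
    ultimately have "q - p = 0"
      using finite_subset poly_roots_finite by blast
    then show "q = p" by simp
  qed
qed

lemma poly_cheb_approx_poly:
  assumes "L > 0" "0 \<le> x" "x \<le> L"
  shows "poly (cheb_approx_poly \<alpha> L m) x = cheb_approx \<alpha> L m x"
  using theI'[OF cheb_approx_poly_ex1[OF assms(1)]] assms(2,3)
  unfolding cheb_approx_poly_def by auto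

text \<open>The class operations \<open>*\<close> and \<open>^\<close> act entrywise on the type \<open>real^'n^'n\<close>, hence the
  iterated \<open>**\<close>.\<close>

definition matrix_poly :: "real poly \<Rightarrow> real^'n^'n \<Rightarrow> real^'n^'n" where
  "matrix_poly p A = (\<Sum>k\<le>degree p. coeff p k *\<^sub>R (((**) A ^^ k) (mat 1)))"

definition std_gaussian_vector :: "'a measure \<Rightarrow> ('a \<Rightarrow> real^'n) \<Rightarrow> bool" where
  "std_gaussian_vector M X \<longleftrightarrow>
     prob_space.indep_vars M (\<lambda>_. borel) (\<lambda>j \<omega>. X \<omega> $ j) UNIV \<and>
     (\<forall>j. distributed M lborel (\<lambda>\<omega>. X \<omega> $ j) std_normal_density)"

definition trace_estimate :: "real \<Rightarrow> nat \<Rightarrow> nat \<Rightarrow> real^'n^'n \<Rightarrow> (nat \<Rightarrow> real^'n) \<Rightarrow> real" where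
  "trace_estimate \<alpha> m s A v =
     1 / real s * (\<Sum>i=1..s. v i \<bullet> (matrix_poly (cheb_approx_poly \<alpha> (lambda_max A) m) A *v v i))"

definition entropy_estimate :: "real \<Rightarrow> nat \<Rightarrow> nat \<Rightarrow> real^'n^'n \<Rightarrow> (nat \<Rightarrow> real^'n) \<Rightarrow> real" where
  "entropy_estimate \<alpha> m s A v = 1 / (1 - \<alpha>) * log 2 (trace_estimate \<alpha> m s A v)"

end

theory Submission
  imports Defs
begin

text \<open>Substituting \<open>x = L * (cos (t / 2))\<^sup>2\<close> turns the Chebyshev series of \<open>x powr \<alpha>\<close> into the cosine series of
  \<open>cos (t / 2) powr (2 * \<alpha>)\<close>. The recurrence of the coefficients gives a first order differential equation
  that identifies the sum of the series (its constant comes from a Beta integral), and it makes the sum of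
  the absolute values of the coefficients beyond \<open>m\<close> telescope. Log-convexity of \<open>Gamma\<close> bounds
  this tail, and the choice of \<open>m\<close> makes the total error on the spectrum at most \<open>\<epsilon> * T\<close>, where \<open>T\<close> is the trace of
  \<open>G\<close> to the power \<open>\<alpha>\<close>.

  If \<open>lambda_min G = 0\<close>, the polynomial of \<open>G\<close> need not be positive semi-definite. The Chernoff bound
  for the Gaussian trace estimate is therefore stated relative to the sum of the absolute eigenvalues, which is at
  most \<open>(1 + \<epsilon>) * T\<close>; the estimate then lies between \<open>(1 - 2 * \<epsilon> - \<epsilon>\<^sup>2) * T\<close> and
  \<open>(1 + \<epsilon>)\<^sup>2 * T\<close>, hence between \<open>(1 - 3 * \<epsilon>) * T\<close> and \<open>T / (1 - 3 * \<epsilon>)\<close>.\<close>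

section \<open>Diagonalisation of symmetric matrices\<close>

text \<open>The coefficient bound controls the error uniformly on \<open>{0..L}\<close>, whereas the
  entropy needs it relative to \<open>T\<close>; this gap explains the two formulas for
  \<open>m\<close>. The tail decays like \<open>(m - \<alpha>) powr (- 2 * \<alpha>)\<close>, so a
  uniform error \<open>L powr \<alpha> / C\<close> costs a term proportional to
  \<open>C powr (1 / (2 * \<alpha>))\<close> in \<open>m\<close>. If
  \<open>lambda_min G > 0\<close>, then \<open>C = \<kappa> powr \<alpha> / \<epsilon>\<close>
  brings the error below \<open>\<epsilon>\<close> times the smallest power on the spectrum, and the
  root turns \<open>\<kappa> powr \<alpha>\<close> into \<open>sqrt \<kappa>\<close>. If
  \<open>lambda_min G = 0\<close>, then \<open>C = n / \<epsilon>\<close> makes the \<open>n\<close>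
  errors together at most \<open>\<epsilon>\<close> times the power of the largest eigenvalue. The
  obstacle in the expansion is convergence: the coefficients decay like
  \<open>k powr (- 2 * \<alpha> - 1)\<close>, so the differentiated series converges absolutely only
  for \<open>\<alpha> > 1 / 2\<close>. Smaller exponents are reached from
  \<open>\<alpha> + 1\<close>.\<close>

lemma self_adjoint_invariant_eigenvector:
  fixes f :: "'a::euclidean_space \<Rightarrow> 'a"
  assumes lin: "linear f" and sym: "\<And>x y. f x \<bullet> y = x \<bullet> f y"
    and W: "subspace W" and inv: "\<And>x. x \<in> W \<Longrightarrow> f x \<in> W" and ne: "w \<in> W" "w \<noteq> 0"
  obtains u c where "u \<in> W" "norm u = 1" "f u = c *\<^sub>R u"
proof -
  interpret f: linear f by (rule lin)
  have "compact (sphere 0 1 \<inter> W)"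
    by (intro compact_Int_closed closed_subspace W) auto
  moreover have "(1 / norm w) *\<^sub>R w \<in> sphere 0 1 \<inter> W"
    using ne by (auto intro: subspace_scale[OF W])
  moreover have "continuous_on (sphere 0 1 \<inter> W) (\<lambda>x. f x \<bullet> x)"
    by (intro continuous_intros linear_continuous_on linear_conv_bounded_linear[THEN iffD1] lin)
  ultimately obtain u where u: "u \<in> sphere 0 1 \<inter> W"
    and max: "\<And>x. x \<in> sphere 0 1 \<inter> W \<Longrightarrow> f x \<bullet> x \<le> f u \<bullet> u"
    using continuous_attains_sup[of "sphere 0 1 \<inter> W" "\<lambda>x. f x \<bullet> x"] by blast
  define c where "c = f u \<bullet> u"
  \<comment> \<open>The residual of the maximiser \<open>u\<close> of the Rayleigh quotient. At
    \<open>u\<close> the gradient of \<open>f x \<bullet> x - c * (x \<bullet> x)\<close> is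
    \<open>- 2 * b\<close>, so a small step along \<open>- b\<close> would exceed the maximum unless
    \<open>b = 0\<close>.\<close>
  define b where "b = c *\<^sub>R u - f u"
  have uW: "u \<in> W" and nu: "norm u = 1" and uu: "u \<bullet> u = 1"
    using u by (auto simp: norm_eq_1)
  have bW: "b \<in> W"
    unfolding b_def by (intro subspace_diff[OF W] subspace_scale[OF W] uW inv)
  have form: "f x \<bullet> x \<le> c * (x \<bullet> x)" if "x \<in> W" for x
  proof (cases "x = 0")
    case False
    have "f ((1 / norm x) *\<^sub>R x) \<bullet> ((1 / norm x) *\<^sub>R x) \<le> c"
      unfolding c_def using that False by (intro max) (auto intro: subspace_scale[OF W])
    then have "f x \<bullet> x / (norm x)\<^sup>2 \<le> c"
      by (simp add: f.scaleR power2_eq_square)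
    then show ?thesis
      using False by (simp add: divide_le_eq dot_square_norm)
  qed (simp add: f.zero)
  have "b \<bullet> b \<le> 0"
  proof (rule ccontr)
    assume "\<not> b \<bullet> b \<le> 0"
    then have bpos: "b \<bullet> b > 0" by linarith
    define K where "K = c * (b \<bullet> b) - f b \<bullet> b"
    have ineq: "0 \<le> 2 * t * (b \<bullet> b) + t\<^sup>2 * K" for t
    proof -
      have "f (u + t *\<^sub>R b) \<bullet> (u + t *\<^sub>R b) \<le> c * ((u + t *\<^sub>R b) \<bullet> (u + t *\<^sub>R b))"
        by (intro form subspace_add[OF W] subspace_scale[OF W] uW bW)
      also have "f (u + t *\<^sub>R b) \<bullet> (u + t *\<^sub>R b) = c + 2 * t * (f u \<bullet> b) + t\<^sup>2 * (f b \<bullet> b)"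
        by (simp add: f.add f.scaleR inner_add_left inner_add_right c_def sym[of b u] inner_commute[of b]
              power2_eq_square algebra_simps)
      also have "(u + t *\<^sub>R b) \<bullet> (u + t *\<^sub>R b) = 1 + 2 * t * (u \<bullet> b) + t\<^sup>2 * (b \<bullet> b)"
        by (simp add: inner_add_left inner_add_right uu inner_commute[of b u] power2_eq_square algebra_simps)
      finally have "0 \<le> 2 * t * (c * (u \<bullet> b) - f u \<bullet> b) + t\<^sup>2 * K"
        by (simp add: K_def algebra_simps)
      moreover have "c * (u \<bullet> b) - f u \<bullet> b = b \<bullet> b"
        by (simp add: b_def inner_diff_left inner_diff_right algebra_simps)
      ultimately show ?thesis by simp
    qed
    \<comment> \<open>A step so short that the quadratic term \<open>e\<^sup>2 * K\<close> uses up
      at most half of the linear gain \<open>2 * e * (b \<bullet> b)\<close>.\<close>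
    define e where "e = (b \<bullet> b) / (\<bar>K\<bar> + 1)"
    have e: "e > 0" "e * (\<bar>K\<bar> + 1) = b \<bullet> b"
      using bpos by (auto simp: e_def)
    have "0 \<le> 2 * (- e) * (b \<bullet> b) + (- e)\<^sup>2 * K"
      by (rule ineq)
    also have "(- e)\<^sup>2 * K \<le> e * (e * (\<bar>K\<bar> + 1))"
      using e(1) by (simp add: power2_eq_square mult.assoc mult_left_mono)
    finally have "0 \<le> - (e * (b \<bullet> b))"
      using e(2) by simp
    then show False
      using e(1) bpos by (simp add: mult_le_0_iff)
  qed
  then have "b = 0"
    by (metis inner_eq_zero_iff inner_ge_zero order_antisym)
  then have "f u = c *\<^sub>R u"
    by (simp add: b_def)
  with that uW nu show ?thesis by blast
qed

text \<open>The induction counts the eigenvectors found so far and leaves the ambient space fixed.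
  Self-adjointness makes the orthogonal complement of these eigenvectors invariant, and it is
  nonzero as long as there are fewer of them than the dimension.\<close>

lemma self_adjoint_orthonormal_eigenvectors:
  fixes f :: "'a::euclidean_space \<Rightarrow> 'a"
  assumes lin: "linear f" and sym: "\<And>x y. f x \<bullet> y = x \<bullet> f y" and "k \<le> DIM('a)"
  shows "\<exists>B. finite B \<and> card B = k \<and> pairwise orthogonal B \<and>
           (\<forall>b\<in>B. norm b = 1 \<and> (\<exists>c. f b = c *\<^sub>R b))"
  using \<open>k \<le> DIM('a)\<close>
proof (induction k)
  case 0
  show ?case by (rule exI[of _ "{}"]) simp
next
  case (Suc k)
  then obtain B where B: "finite B" "card B = k" "pairwise orthogonal B"
    "\<And>b. b \<in> B \<Longrightarrow> norm b = 1" "\<And>b. b \<in> B \<Longrightarrow> \<exists>c. f b = c *\<^sub>R b"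
    by auto
  define W where "W = {x. \<forall>b\<in>B. x \<bullet> b = 0}"
  have "dim B \<le> k"
    using dim_le_card'[OF B(1)] B(2) by simp
  then have "dim B < DIM('a)"
    using Suc.prems by simp
  then obtain w where w: "w \<noteq> 0" "\<And>y. y \<in> span B \<Longrightarrow> orthogonal w y"
    using orthogonal_to_subspace_exists by blast
  have wW: "w \<in> W"
    using w(2) by (auto simp: W_def orthogonal_def span_base)
  have sW: "subspace W"
    by (auto simp: W_def subspace_def inner_add_left)
  have inv: "f x \<in> W" if "x \<in> W" for x
    unfolding W_def
  proof safe
    fix b assume b: "b \<in> B"
    then obtain c where "f b = c *\<^sub>R b" using B(5) by blast
    then show "f x \<bullet> b = 0"
      using that b by (simp add: sym W_def)
  qed
  obtain u c where u: "u \<in> W" "norm u = 1" "f u = c *\<^sub>R u"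
    using self_adjoint_invariant_eigenvector[OF lin sym sW inv wW w(1)] by blast
  have orth: "orthogonal u b" "orthogonal b u" if "b \<in> B" for b
    using u(1) that by (auto simp: W_def orthogonal_def inner_commute)
  have "u \<notin> B"
    using orth(1)[of u] u(2) by (auto simp: orthogonal_def)
  then show ?case
    using B u orth by (intro exI[of _ "insert u B"]) (auto simp: pairwise_insert)
qed

text \<open>Indexing by the matrix index type makes such a family a full basis with one eigenvalue
  per index, so multiplicities need no separate bookkeeping.\<close>

definition orthonormal_family :: "('n::finite \<Rightarrow> real^'n) \<Rightarrow> bool" where
  "orthonormal_family q \<longleftrightarrow> (\<forall>i j. q i \<bullet> q j = (if i = j then 1 else 0))"

theorem symmetric_matrix_diagonalization:
  fixes A :: "real^'n^'n"
  assumes "transpose A = A"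
  obtains q d where "orthonormal_family q" "\<And>i. A *v q i = d i *\<^sub>R q i"
proof -
  have sym: "(A *v x) \<bullet> y = x \<bullet> (A *v y)" for x y
    by (metis assms dot_lmul_matrix vector_transpose_matrix)
  obtain B where B: "finite B" "card B = CARD('n)" "pairwise orthogonal B"
    "\<And>b. b \<in> B \<Longrightarrow> norm b = 1" "\<And>b. b \<in> B \<Longrightarrow> \<exists>c. A *v b = c *\<^sub>R b"
    using self_adjoint_orthonormal_eigenvectors[of "(*v) A" "CARD('n)"] sym by auto
  obtain q where q: "bij_betw q (UNIV :: 'n set) B"
    using finite_same_card_bij[OF finite B(1)] B(2) by metis
  have qB: "q i \<in> B" for i using q by (auto simp: bij_betw_def)
  obtain d where "\<And>i. A *v q i = d i *\<^sub>R q i"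
    using B(5)[OF qB] by metis
  moreover have "orthonormal_family q"
    unfolding orthonormal_family_def
  proof (intro allI)
    fix i j
    show "q i \<bullet> q j = (if i = j then 1 else 0)"
      using pairwiseD[OF B(3) qB qB, of i j] B(4)[OF qB] bij_betw_imp_inj_on[OF q]
      by (auto simp: orthogonal_def inj_eq dot_square_norm)
  qed
  ultimately show ?thesis using that by blast
qed

lemma orthonormal_family_expand:
  fixes x :: "real^'n"
  assumes "orthonormal_family q"
  shows "(\<Sum>i\<in>UNIV. (q i \<bullet> x) *\<^sub>R q i) = x"
proof -
  have inj: "inj q"
  proof (rule injI)
    fix i j assume "q i = q j"
    then have "q i \<bullet> q j = 1"
      using assms unfolding orthonormal_family_def by metis
    then show "i = j"
      using assms unfolding orthonormal_family_def by (metis zero_neq_one)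
  qed
  have po: "pairwise orthogonal (range q)"
    using assms by (auto simp: pairwise_def orthogonal_def orthonormal_family_def)
  have n1: "norm b = 1" if "b \<in> range q" for b
    using assms that by (auto simp: norm_eq_1 orthonormal_family_def)
  have "independent (range q)"
    using n1[of 0] by (intro pairwise_orthogonal_independent po) auto
  moreover have "card (range q) = DIM(real^'n)"
    by (simp add: card_image inj)
  ultimately have "x \<in> span (range q)"
    using card_eq_dim[of "range q" "UNIV :: (real^'n) set"] by auto
  from orthonormal_basis_expand[OF po n1 this]
  have "x = (\<Sum>v\<in>range q. (x \<bullet> v) *\<^sub>R v)" by simp
  also have "\<dots> = (\<Sum>i\<in>UNIV. (x \<bullet> q i) *\<^sub>R q i)"
    by (subst sum.reindex) (use inj in auto)
  finally show ?thesis by (simp add: inner_commute)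
qed

lemma orthonormal_family_norm_sq:
  fixes x :: "real^'n"
  assumes "orthonormal_family q"
  shows "(\<Sum>i\<in>UNIV. (q i \<bullet> x)\<^sup>2) = (norm x)\<^sup>2"
proof -
  have "(norm x)\<^sup>2 = x \<bullet> (\<Sum>i\<in>UNIV. (q i \<bullet> x) *\<^sub>R q i)"
    by (simp add: orthonormal_family_expand[OF assms] dot_square_norm)
  then show ?thesis
    by (simp add: inner_sum_right power2_eq_square inner_commute)
qed

lemma quadratic_form_eigenbasis:
  fixes B :: "real^'n^'n"
  assumes q: "orthonormal_family q" and eig: "\<And>i. B *v q i = \<mu> i *\<^sub>R q i"
  shows "x \<bullet> (B *v x) = (\<Sum>i\<in>UNIV. \<mu> i * (q i \<bullet> x)\<^sup>2)"
proof -
  have "B *v x = B *v (\<Sum>i\<in>UNIV. (q i \<bullet> x) *\<^sub>R q i)"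
    by (simp add: orthonormal_family_expand[OF q])
  also have "\<dots> = (\<Sum>i\<in>UNIV. ((q i \<bullet> x) * \<mu> i) *\<^sub>R q i)"
    by (simp add: linear_sum matrix_vector_mult_scaleR eig)
  finally show ?thesis
    by (simp add: inner_sum_right power2_eq_square inner_commute mult_ac)
qed

section \<open>Spectrum and matrix polynomials in an eigenbasis\<close>

text \<open>Conjugation by the orthogonal matrix with columns \<open>q j\<close> diagonalises
  \<open>mat t - A\<close> for every \<open>t\<close>. This ties the eigenvalues, defined as roots
  with multiplicity, to the family \<open>d\<close>.\<close>

lemma charpoly_eq_prod:
  fixes A :: "real^'n^'n"
  assumes q: "orthonormal_family q" and eig: "\<And>i. A *v q i = d i *\<^sub>R q i"
  shows "charpoly A = (\<Prod>i\<in>UNIV. [:- d i, 1:])"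
proof (rule poly_eq_poly_eq_iff[THEN iffD1], rule ext)
  fix t
  define Q :: "real^'n^'n" where "Q = (\<chi> i j. q j $ i)"
  define D :: "real^'n^'n" where "D = (\<chi> i j. if i = j then t - d i else 0)"
  have QQ: "transpose Q ** Q = mat 1"
    using q by (simp add: vec_eq_iff matrix_matrix_mult_def transpose_def Q_def mat_def
        orthonormal_family_def inner_vec_def mult.commute)
  then have QQ': "Q ** transpose Q = mat 1"
    by (simp add: matrix_left_right_inverse)
  have AQ: "(A ** Q) $ i $ j = d j * Q $ i $ j" for i j
  proof -
    have "(A ** Q) $ i $ j = (A *v q j) $ i"
      by (simp add: matrix_matrix_mult_def matrix_vector_mult_def Q_def)
    then show ?thesis by (simp add: eig Q_def)
  qed
  have "(mat t - A) ** Q = Q ** D"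
  proof -
    have "((mat t - A) ** Q) $ i $ j = (Q ** D) $ i $ j" for i j
    proof -
      have "(mat t ** Q) $ i $ j = t * Q $ i $ j"
        by (simp add: matrix_matrix_mult_def mat_def if_distrib[of "\<lambda>x. x * _"] cong: if_cong)
      moreover have "(Q ** D) $ i $ j = Q $ i $ j * (t - d j)"
        by (simp add: matrix_matrix_mult_def D_def if_distrib[of "\<lambda>x. _ * x"] cong: if_cong)
      moreover have "((mat t - A) ** Q) $ i $ j = (mat t ** Q) $ i $ j - (A ** Q) $ i $ j"
        by (simp add: matrix_matrix_mult_def left_diff_distrib sum_subtractf)
      ultimately show ?thesis
        by (simp add: AQ algebra_simps)
    qed
    then show ?thesis by (simp add: vec_eq_iff)
  qed
  then have "mat t - A = Q ** D ** transpose Q"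
    by (metis QQ' matrix_mul_assoc matrix_mul_rid)
  then have "det (mat t - A) = det D * det (Q ** transpose Q)"
    by (simp add: det_mul)
  also have "\<dots> = (\<Prod>i\<in>UNIV. t - d i)"
    by (simp add: QQ' det_diagonal D_def)
  finally show "poly (charpoly A) t = poly (\<Prod>i\<in>UNIV. [:- d i, 1:]) t"
    by (simp add: poly_charpoly poly_prod)
qed

lemma eigenvalues_eq_image:
  fixes A :: "real^'n^'n"
  assumes q: "orthonormal_family q" and eig: "\<And>i. A *v q i = d i *\<^sub>R q i"
  shows "eigenvalues A = image_mset d (mset_set UNIV)"
  unfolding eigenvalues_def charpoly_eq_prod[OF assms]
  by (subst proots_prod) (auto simp: sum_unfold_sum_mset)

text \<open>Any eigenbasis of \<open>A\<close> thus also diagonalises every polynomial in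
  \<open>A\<close>, and only the values of the polynomial on the spectrum matter.\<close>

lemma matrix_poly_eigenvector:
  fixes A :: "real^'n^'n"
  assumes "A *v v = c *\<^sub>R v"
  shows "matrix_poly p A *v v = poly p c *\<^sub>R v"
proof -
  have pow: "((**) A ^^ k) (mat 1) *v v = c ^ k *\<^sub>R v" for k
  proof (induction k)
    case (Suc k)
    have "((**) A ^^ Suc k) (mat 1) *v v = A *v (((**) A ^^ k) (mat 1) *v v)"
      by (simp add: matrix_vector_mul_assoc)
    then show ?case
      by (simp add: Suc matrix_vector_mult_scaleR assms mult.commute)
  qed simp
  have "matrix_poly p A *v v = (\<Sum>k\<le>degree p. (coeff p k *\<^sub>R ((**) A ^^ k) (mat 1)) *v v)"
    unfolding matrix_poly_def
    by (induction rule: finite_induct[OF finite_atMost[of "degree p"]])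
       (auto simp: matrix_vector_mult_add_rdistrib)
  also have "\<dots> = (\<Sum>k\<le>degree p. (coeff p k * c ^ k) *\<^sub>R v)"
    by (intro sum.cong) (auto simp: scaleR_matrix_vector_assoc[symmetric] pow)
  also have "\<dots> = poly p c *\<^sub>R v"
    by (simp add: poly_altdef scaleR_sum_left)
  finally show ?thesis .
qed

section \<open>Quadratic forms in Gaussian vectors\<close>

text \<open>Completing the square turns the integrand into a constant multiple of the normal density
  with mean \<open>b / k\<close> and variance \<open>1 / k\<close>, where
  \<open>k = 1 - 2 * a\<close> is positive. Nonnegative integrals avoid every question of
  integrability here and in the exchange of integrals below.\<close>

lemma nn_integral_exp_quadratic_std_normal:
  assumes "a < 1 / 2"
  shows "(\<integral>\<^sup>+x. ennreal (std_normal_density x) * ennreal (exp (a * x\<^sup>2 + b * x)) \<partial>lborel)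
           = ennreal (exp (b\<^sup>2 / (2 * (1 - 2 * a))) / sqrt (1 - 2 * a))"
proof -
  define k where "k = 1 - 2 * a"
  have k: "k > 0" "a = (1 - k) / 2"
    using assms by (auto simp: k_def)
  define K where "K = exp (b\<^sup>2 / (2 * k)) / sqrt k"
  have K: "K \<ge> 0" using k by (simp add: K_def)
  have "std_normal_density x * exp (a * x\<^sup>2 + b * x) = K * normal_density (b / k) (1 / sqrt k) x" for x
  proof -
    have "- x\<^sup>2 / 2 + (a * x\<^sup>2 + b * x) = b\<^sup>2 / (2 * k) + - (x - b / k)\<^sup>2 / (2 * (1 / sqrt k)\<^sup>2)"
      using k(1) unfolding k(2) by (simp add: power_divide field_simps power2_eq_square)
    then have "exp (- x\<^sup>2 / 2) * exp (a * x\<^sup>2 + b * x)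
        = exp (b\<^sup>2 / (2 * k)) * exp (- (x - b / k)\<^sup>2 / (2 * (1 / sqrt k)\<^sup>2))"
      by (simp flip: exp_add)
    moreover have "1 / sqrt (2 * pi * (1 / sqrt k)\<^sup>2) = sqrt k / sqrt (2 * pi)"
      using k(1) by (simp add: real_sqrt_divide power_divide)
    moreover have "std_normal_density x * exp (a * x\<^sup>2 + b * x)
        = 1 / sqrt (2 * pi) * (exp (- x\<^sup>2 / 2) * exp (a * x\<^sup>2 + b * x))"
      by (simp add: std_normal_density_def)
    ultimately show ?thesis
      using k(1) by (simp only: normal_density_def K_def) simp
  qed
  then have "(\<integral>\<^sup>+x. ennreal (std_normal_density x) * ennreal (exp (a * x\<^sup>2 + b * x)) \<partial>lborel)
      = (\<integral>\<^sup>+x. ennreal K * ennreal (normal_density (b / k) (1 / sqrt k) x) \<partial>lborel)"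
    by (simp add: K flip: ennreal_mult)
  also have "\<dots> = ennreal K * ennreal (\<integral>x. normal_density (b / k) (1 / sqrt k) x \<partial>lborel)"
    using k(1) nn_integral_eq_integral[of lborel "normal_density (b / k) (1 / sqrt k)"]
    by (subst nn_integral_cmult) auto
  also have "\<dots> = ennreal K"
    using k by simp
  finally show ?thesis by (simp add: K_def k_def)
qed

text \<open>The exponential of each square \<open>(q i \<bullet> X)\<^sup>2\<close> is linearised by averaging over an auxiliary
  standard normal variable; exchanging the two expectations then replaces a rotation of \<open>X\<close>. The
  shift by \<open>c\<close> makes all coefficients of the squares nonnegative.\<close>

lemma (in prob_space) std_gaussian_quadratic_mgf:
  fixes X :: "'a \<Rightarrow> real^'n"
  assumes X: "std_gaussian_vector M X" and q: "orthonormal_family q"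
    and \<mu>: "\<And>i. \<mu> i < 1 / 2"
  shows "(\<integral>\<^sup>+\<omega>. ennreal (exp (\<Sum>i\<in>UNIV. \<mu> i * (q i \<bullet> X \<omega>)\<^sup>2)) \<partial>M)
           = ennreal (\<Prod>i\<in>UNIV. 1 / sqrt (1 - 2 * \<mu> i))"
proof -
  define c where "c = (\<Sum>i\<in>UNIV. \<bar>\<mu> i\<bar>)"
  define \<nu> where "\<nu> i = \<mu> i + c" for i
  have c0: "c \<ge> 0" by (auto simp: c_def intro: sum_nonneg)
  have \<nu>0: "\<nu> i \<ge> 0" for i
    using member_le_sum[of i UNIV "\<lambda>i. \<bar>\<mu> i\<bar>"] by (simp add: \<nu>_def c_def)
  have ind: "indep_vars (\<lambda>_. borel) (\<lambda>j \<omega>. X \<omega> $ j) UNIV"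
    and dis: "\<And>j. distributed M lborel (\<lambda>\<omega>. X \<omega> $ j) std_normal_density"
    using X by (auto simp: std_gaussian_vector_def)
  have meas [measurable]: "(\<lambda>\<omega>. X \<omega> $ j) \<in> borel_measurable M" for j
    using distributed_measurable[OF dis[of j]] by simp
  define N where "N = density lborel (\<lambda>x. ennreal (std_normal_density x))"
  interpret N: prob_space N
    unfolding N_def by (rule prob_space_normal_density) simp
  interpret P: product_prob_space "\<lambda>_::'n. N" UNIV ..
  interpret P': finite_product_prob_space "\<lambda>_::'n. N" UNIV by unfold_locales simp
  have sN [measurable_cong]: "sets N = sets borel" by (simp add: N_def)
  have N_exp: "(\<integral>\<^sup>+x. ennreal (exp (a * x\<^sup>2 + b * x)) \<partial>N)
           = ennreal (exp (b\<^sup>2 / (2 * (1 - 2 * a))) / sqrt (1 - 2 * a))" if "a < 1 / 2" for a b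
    using nn_integral_exp_quadratic_std_normal[OF that] by (simp add: N_def nn_integral_density)
  have X_exp: "(\<integral>\<^sup>+\<omega>. ennreal (exp (a * (X \<omega> $ j)\<^sup>2 + b * X \<omega> $ j)) \<partial>M)
           = ennreal (exp (b\<^sup>2 / (2 * (1 - 2 * a))) / sqrt (1 - 2 * a))" if "a < 1 / 2" for a b j
    using nn_integral_exp_quadratic_std_normal[OF that]
    by (subst distributed_nn_integral[OF dis, symmetric]) simp_all
  \<comment> \<open>For fixed \<open>X\<close>, averaging \<open>exp (v z \<bullet> X)\<close> over
    independent standard normal \<open>z i\<close> gives the exponential of the sum of
    \<open>\<nu> i * (q i \<bullet> X)\<^sup>2\<close>.\<close>
  define v where "v z = (\<Sum>i\<in>UNIV. (sqrt (2 * \<nu> i) * z i) *\<^sub>R q i)" for z :: "'n \<Rightarrow> real"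
  have v_inner: "v z \<bullet> x = (\<Sum>i\<in>UNIV. sqrt (2 * \<nu> i) * z i * (q i \<bullet> x))" for z x
    by (simp add: v_def inner_sum_left)
  have "q i \<bullet> v z = sqrt (2 * \<nu> i) * z i" for i z
    using q unfolding orthonormal_family_def
    by (simp add: v_def inner_sum_right if_distrib[of "\<lambda>x. _ * x"] cong: if_cong)
  then have v_norm: "(norm (v z))\<^sup>2 = (\<Sum>i\<in>UNIV. 2 * \<nu> i * (z i)\<^sup>2)" for z
    using orthonormal_family_norm_sq[OF q, of "v z"] \<nu>0 by (simp add: power_mult_distrib)
  have v_meas: "(\<lambda>z. v z $ j) \<in> borel_measurable (Pi\<^sub>M UNIV (\<lambda>_. N))" for j
    unfolding v_def sum_component vector_scaleR_component real_scaleR_def by measurable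
  note v_meas [measurable]
  \<comment> \<open>The shift costs \<open>- c * (norm X)\<^sup>2\<close>, which is the same in the
    basis \<open>q\<close> and in the coordinates. For fixed \<open>z\<close> the exponent is
    therefore a sum of functions of single, independent coordinates of \<open>X\<close>.\<close>
  define h where "h z \<omega> = (\<Sum>j\<in>UNIV. - c * (X \<omega> $ j)\<^sup>2 + v z $ j * X \<omega> $ j)" for z \<omega>
  have "(\<integral>\<^sup>+\<omega>. ennreal (exp (\<Sum>i\<in>UNIV. \<mu> i * (q i \<bullet> X \<omega>)\<^sup>2)) \<partial>M)
      = (\<integral>\<^sup>+\<omega>. (\<integral>\<^sup>+z. ennreal (exp (h z \<omega>)) \<partial>Pi\<^sub>M UNIV (\<lambda>_. N)) \<partial>M)"
  proof (intro nn_integral_cong)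
    fix \<omega>
    let ?y = "\<lambda>i. q i \<bullet> X \<omega>"
    have sq: "(\<Sum>j\<in>UNIV. (X \<omega> $ j)\<^sup>2) = (norm (X \<omega>))\<^sup>2"
      by (simp add: norm_vec_def L2_set_def sum_nonneg)
    have h_eq: "h z \<omega> = - c * (norm (X \<omega>))\<^sup>2 + (\<Sum>i\<in>UNIV. (sqrt (2 * \<nu> i) * ?y i) * z i)" for z
    proof -
      have "h z \<omega> = - c * (\<Sum>j\<in>UNIV. (X \<omega> $ j)\<^sup>2) + v z \<bullet> X \<omega>"
        by (simp add: h_def sum.distrib sum_distrib_left inner_vec_def sum_negf sum_subtractf)
      then show ?thesis by (simp add: sq v_inner mult_ac)
    qed
    have "(\<Sum>i\<in>UNIV. \<mu> i * (?y i)\<^sup>2) = - c * (norm (X \<omega>))\<^sup>2 + (\<Sum>i\<in>UNIV. \<nu> i * (?y i)\<^sup>2)"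
      by (simp add: \<nu>_def ring_distribs sum.distrib sum_distrib_left[symmetric] orthonormal_family_norm_sq[OF q])
    then have "exp (\<Sum>i\<in>UNIV. \<mu> i * (?y i)\<^sup>2)
        = exp (- c * (norm (X \<omega>))\<^sup>2) * (\<Prod>i\<in>UNIV. exp (\<nu> i * (?y i)\<^sup>2))"
      by (simp only: exp_add exp_sum finite)
    then have "ennreal (exp (\<Sum>i\<in>UNIV. \<mu> i * (?y i)\<^sup>2))
        = ennreal (exp (- c * (norm (X \<omega>))\<^sup>2)) * (\<Prod>i\<in>UNIV. ennreal (exp (\<nu> i * (?y i)\<^sup>2)))"
      by (simp add: prod_ennreal prod_nonneg flip: ennreal_mult)
    also have "(\<Prod>i\<in>UNIV. ennreal (exp (\<nu> i * (?y i)\<^sup>2)))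
        = (\<Prod>i\<in>UNIV. \<integral>\<^sup>+x. ennreal (exp ((sqrt (2 * \<nu> i) * ?y i) * x)) \<partial>N)"
      using N_exp[of 0] \<nu>0 by (simp add: power_mult_distrib)
    also have "\<dots> = (\<integral>\<^sup>+z. (\<Prod>i\<in>UNIV. ennreal (exp ((sqrt (2 * \<nu> i) * ?y i) * z i))) \<partial>Pi\<^sub>M UNIV (\<lambda>_. N))"
      by (rule P.product_nn_integral_prod[symmetric]) auto
    also have "ennreal (exp (- c * (norm (X \<omega>))\<^sup>2)) * \<dots>
        = (\<integral>\<^sup>+z. ennreal (exp (- c * (norm (X \<omega>))\<^sup>2)) *
             (\<Prod>i\<in>UNIV. ennreal (exp ((sqrt (2 * \<nu> i) * ?y i) * z i))) \<partial>Pi\<^sub>M UNIV (\<lambda>_. N))"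
      by (rule nn_integral_cmult[symmetric]) measurable
    also have "\<dots> = (\<integral>\<^sup>+z. ennreal (exp (h z \<omega>)) \<partial>Pi\<^sub>M UNIV (\<lambda>_. N))"
    proof (intro nn_integral_cong)
      fix z
      have "exp (h z \<omega>) = exp (- c * (norm (X \<omega>))\<^sup>2) * (\<Prod>i\<in>UNIV. exp ((sqrt (2 * \<nu> i) * ?y i) * z i))"
        by (simp only: h_eq exp_add exp_sum finite)
      then show "ennreal (exp (- c * (norm (X \<omega>))\<^sup>2)) *
             (\<Prod>i\<in>UNIV. ennreal (exp ((sqrt (2 * \<nu> i) * ?y i) * z i))) = ennreal (exp (h z \<omega>))"
        by (simp add: prod_ennreal prod_nonneg flip: ennreal_mult)
    qed
    finally show "ennreal (exp (\<Sum>i\<in>UNIV. \<mu> i * (?y i)\<^sup>2)) = \<dots>" .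
  qed
  also have "\<dots> = (\<integral>\<^sup>+z. (\<integral>\<^sup>+\<omega>. ennreal (exp (h z \<omega>)) \<partial>M) \<partial>Pi\<^sub>M UNIV (\<lambda>_. N))"
  proof -
    interpret pair_sigma_finite M "Pi\<^sub>M UNIV (\<lambda>_::'n. N)" ..
    show ?thesis
      unfolding h_def by (rule Fubini'[symmetric]) measurable
  qed
  also have "\<dots> = (\<integral>\<^sup>+z. (\<Prod>i\<in>UNIV. ennreal (exp (\<nu> i / (1 + 2 * c) * (z i)\<^sup>2) / sqrt (1 + 2 * c)))
       \<partial>Pi\<^sub>M UNIV (\<lambda>_. N))"
  proof (intro nn_integral_cong)
    fix z :: "'n \<Rightarrow> real"
    have "(\<integral>\<^sup>+\<omega>. ennreal (exp (h z \<omega>)) \<partial>M)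
        = (\<integral>\<^sup>+\<omega>. (\<Prod>j\<in>UNIV. ennreal (exp (- c * (X \<omega> $ j)\<^sup>2 + v z $ j * X \<omega> $ j))) \<partial>M)"
      by (simp add: h_def exp_sum prod_ennreal)
    also have "\<dots> = (\<Prod>j\<in>UNIV. \<integral>\<^sup>+\<omega>. ennreal (exp (- c * (X \<omega> $ j)\<^sup>2 + v z $ j * X \<omega> $ j)) \<partial>M)"
      by (intro indep_vars_nn_integral indep_vars_compose2[OF ind]) auto
    also have "\<dots> = (\<Prod>j\<in>UNIV. ennreal (exp ((v z $ j)\<^sup>2 / (2 * (1 - 2 * (- c)))) / sqrt (1 - 2 * (- c))))"
      using c0 by (subst X_exp) auto
    also have "\<dots> = ennreal (exp (\<Sum>j\<in>UNIV. (v z $ j)\<^sup>2 / (2 * (1 + 2 * c))) / (\<Prod>j\<in>(UNIV::'n set). sqrt (1 + 2 * c)))"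
      using c0 by (simp add: prod_ennreal exp_sum prod_dividef del: prod_constant)
    also have "(\<Sum>j\<in>UNIV. (v z $ j)\<^sup>2 / (2 * (1 + 2 * c))) = (norm (v z))\<^sup>2 / (2 * (1 + 2 * c))"
      by (simp add: norm_vec_def L2_set_def sum_nonneg sum_divide_distrib)
    also have "\<dots> = (\<Sum>i\<in>UNIV. \<nu> i / (1 + 2 * c) * (z i)\<^sup>2)"
      unfolding v_norm sum_divide_distrib using c0 by (intro sum.cong) (auto simp: field_simps)
    also have "ennreal (exp \<dots> / (\<Prod>j\<in>(UNIV::'n set). sqrt (1 + 2 * c)))
       = (\<Prod>i\<in>UNIV. ennreal (exp (\<nu> i / (1 + 2 * c) * (z i)\<^sup>2) / sqrt (1 + 2 * c)))"
      using c0 by (simp add: prod_ennreal exp_sum prod_dividef del: prod_constant)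
    finally show "(\<integral>\<^sup>+\<omega>. ennreal (exp (h z \<omega>)) \<partial>M) = \<dots>" .
  qed
  also have "\<dots> = (\<Prod>i\<in>UNIV. \<integral>\<^sup>+x. ennreal (exp (\<nu> i / (1 + 2 * c) * x\<^sup>2) / sqrt (1 + 2 * c)) \<partial>N)"
    by (rule P.product_nn_integral_prod) auto
  also have "\<dots> = (\<Prod>i\<in>UNIV. ennreal (1 / sqrt (1 - 2 * \<mu> i)))"
  proof (intro prod.cong refl)
    fix i
    \<comment> \<open>The shift cancels, since
      \<open>1 + 2 * c - 2 * \<nu> i = 1 - 2 * \<mu> i\<close>; the factor
      \<open>1 / sqrt (1 + 2 * c)\<close> left by the integral over \<open>X\<close> absorbs the
      remaining denominator.\<close>
    have k: "1 - 2 * (\<nu> i / (1 + 2 * c)) = (1 - 2 * \<mu> i) / (1 + 2 * c)"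
      using c0 by (simp add: \<nu>_def field_simps)
    have pos: "(1 - 2 * \<mu> i) / (1 + 2 * c) > 0"
      using c0 \<mu>[of i] by (intro divide_pos_pos) auto
    then have lt: "\<nu> i / (1 + 2 * c) < 1 / 2"
      unfolding k[symmetric] by linarith
    have "(\<integral>\<^sup>+x. ennreal (exp (\<nu> i / (1 + 2 * c) * x\<^sup>2) / sqrt (1 + 2 * c)) \<partial>N)
        = (\<integral>\<^sup>+x. ennreal (1 / sqrt (1 + 2 * c)) * ennreal (exp (\<nu> i / (1 + 2 * c) * x\<^sup>2 + 0 * x)) \<partial>N)"
      using c0 by (intro nn_integral_cong) (simp flip: ennreal_mult)
    also have "\<dots> = ennreal (1 / sqrt (1 + 2 * c)) *
        (\<integral>\<^sup>+x. ennreal (exp (\<nu> i / (1 + 2 * c) * x\<^sup>2 + 0 * x)) \<partial>N)"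
      by (rule nn_integral_cmult) measurable
    also have "(\<integral>\<^sup>+x. ennreal (exp (\<nu> i / (1 + 2 * c) * x\<^sup>2 + 0 * x)) \<partial>N)
        = ennreal (1 / sqrt ((1 - 2 * \<mu> i) / (1 + 2 * c)))"
      using N_exp[OF lt, of 0] unfolding k by simp
    also have "ennreal (1 / sqrt (1 + 2 * c)) * ennreal (1 / sqrt ((1 - 2 * \<mu> i) / (1 + 2 * c)))
        = ennreal (1 / sqrt (1 - 2 * \<mu> i))"
    proof -
      have "1 / sqrt K * (1 / sqrt (a / K)) = 1 / sqrt a" if "K > 0" for a K :: real
        using that by (simp add: real_sqrt_divide)
      from this[of "1 + 2 * c" "1 - 2 * \<mu> i"] show ?thesis
        using c0 by (subst ennreal_mult'[symmetric]) auto
    qed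
    finally show "(\<integral>\<^sup>+x. ennreal (exp (\<nu> i / (1 + 2 * c) * x\<^sup>2) / sqrt (1 + 2 * c)) \<partial>N)
        = ennreal (1 / sqrt (1 - 2 * \<mu> i))" .
  qed
  also have "\<dots> = ennreal (\<Prod>i\<in>UNIV. 1 / sqrt (1 - 2 * \<mu> i))"
  proof (intro prod_ennreal)
    show "0 \<le> 1 / sqrt (1 - 2 * \<mu> i)" for i
      using \<mu>[of i] by simp
  qed
  finally show ?thesis .
qed

section \<open>Chernoff bounds for averages of Gaussian quadratic forms\<close>

text \<open>The difference of the two sides has derivative \<open>t * (1 - 2 * t) / (1 - t)\<close>,
  which has the sign of \<open>t\<close> up to \<open>1 / 2\<close>; so the difference is smallest
  at 0, where it vanishes.\<close>

lemma ln_one_minus_ge: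
  fixes x :: real
  assumes "\<bar>x\<bar> \<le> 1 / 2"
  shows "- x - x\<^sup>2 \<le> ln (1 - x)"
proof -
  define f where "f = (\<lambda>x::real. ln (1 - x) + x + x\<^sup>2)"
  have der: "(f has_real_derivative t * (1 - 2 * t) / (1 - t)) (at t)" if "t < 1" for t
    unfolding f_def by (rule derivative_eq_intros refl | use that in \<open>force simp: field_simps\<close>)+
  have "f 0 \<le> f x"
  proof (cases "x \<ge> 0")
    case True
    show ?thesis
    proof (rule DERIV_nonneg_imp_nondecreasing[OF True, of f])
      fix t assume "0 \<le> t" "t \<le> x"
      then show "\<exists>y. (f has_real_derivative y) (at t) \<and> 0 \<le> y"
        using assms by (intro exI[of _ "t * (1 - 2 * t) / (1 - t)"] conjI der) auto
    qed
  next
    case False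
    show ?thesis
    proof (rule DERIV_nonpos_imp_nonincreasing[of x 0 f])
      fix t assume t: "x \<le> t" "t \<le> 0"
      have "t * (1 - 2 * t) / (1 - t) \<le> 0"
        using t by (intro divide_nonpos_pos mult_nonpos_nonneg) auto
      then show "\<exists>y. (f has_real_derivative y) (at t) \<and> y \<le> 0"
        using t by (intro exI[of _ "t * (1 - 2 * t) / (1 - t)"] conjI der) auto
    qed (use False in auto)
  qed
  then show ?thesis by (simp add: f_def)
qed

text \<open>Centring cancels the linear term of the logarithm: each factor is
  \<open>exp (- \<mu> i - ln (1 - 2 * \<mu> i) / 2)\<close>, and the second-order bound at
  \<open>2 * \<mu> i\<close> leaves \<open>2 * (\<mu> i)\<^sup>2\<close>. The range
  \<open>1 / 4\<close> is what that bound allows.\<close>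

lemma (in prob_space) std_gaussian_centered_mgf_le:
  fixes X :: "'a \<Rightarrow> real^'n"
  assumes X: "std_gaussian_vector M X" and q: "orthonormal_family q"
    and \<mu>: "\<And>i. \<bar>\<mu> i\<bar> \<le> 1 / 4"
  shows "(\<integral>\<^sup>+\<omega>. ennreal (exp (\<Sum>i\<in>UNIV. \<mu> i * ((q i \<bullet> X \<omega>)\<^sup>2 - 1))) \<partial>M)
           \<le> ennreal (exp (2 * (\<Sum>i\<in>UNIV. (\<mu> i)\<^sup>2)))"
proof -
  have lt: "\<mu> i < 1 / 2" and lt': "2 * \<mu> i \<le> 1" for i using \<mu>[of i] by linarith+
  have meas [measurable]: "(\<lambda>\<omega>. X \<omega> $ j) \<in> borel_measurable M" for j
    using X distributed_measurable[of M lborel "\<lambda>\<omega>. X \<omega> $ j"] by (auto simp: std_gaussian_vector_def)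
  have "exp (\<Sum>i\<in>UNIV. \<mu> i * ((q i \<bullet> X \<omega>)\<^sup>2 - 1))
      = exp (\<Sum>i\<in>UNIV. - \<mu> i) * exp (\<Sum>i\<in>UNIV. \<mu> i * (q i \<bullet> X \<omega>)\<^sup>2)" for \<omega>
    by (simp add: right_diff_distrib sum_subtractf sum_negf exp_diff exp_minus divide_inverse)
  then have "(\<integral>\<^sup>+\<omega>. ennreal (exp (\<Sum>i\<in>UNIV. \<mu> i * ((q i \<bullet> X \<omega>)\<^sup>2 - 1))) \<partial>M)
      = (\<integral>\<^sup>+\<omega>. ennreal (exp (\<Sum>i\<in>UNIV. - \<mu> i)) * ennreal (exp (\<Sum>i\<in>UNIV. \<mu> i * (q i \<bullet> X \<omega>)\<^sup>2)) \<partial>M)"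
    by (simp add: ennreal_mult)
  also have "\<dots> = ennreal (exp (\<Sum>i\<in>UNIV. - \<mu> i)) * ennreal (\<Prod>i\<in>UNIV. 1 / sqrt (1 - 2 * \<mu> i))"
    using std_gaussian_quadratic_mgf[OF X q lt]
    by (subst nn_integral_cmult) (auto simp: inner_vec_def)
  also have "\<dots> = ennreal (\<Prod>i\<in>UNIV. exp (- \<mu> i) * (1 / sqrt (1 - 2 * \<mu> i)))"
    unfolding prod.distrib exp_sum[OF finite]
    by (rule ennreal_mult[symmetric]) (use lt' in \<open>auto intro!: prod_nonneg\<close>)
  also have "\<dots> \<le> ennreal (\<Prod>i\<in>UNIV. exp (2 * (\<mu> i)\<^sup>2))"
  proof (intro ennreal_leI prod_mono conjI)
    fix i
    have "- (2 * \<mu> i) - (2 * \<mu> i)\<^sup>2 \<le> ln (1 - 2 * \<mu> i)"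
      using \<mu>[of i] by (intro ln_one_minus_ge) auto
    then have "exp (- \<mu> i - 2 * (\<mu> i)\<^sup>2) \<le> exp (ln (sqrt (1 - 2 * \<mu> i)))"
      using lt[of i] by (simp add: ln_sqrt power2_eq_square)
    then show "exp (- \<mu> i) * (1 / sqrt (1 - 2 * \<mu> i)) \<le> exp (2 * (\<mu> i)\<^sup>2)"
      using lt[of i] by (simp add: exp_diff field_simps)
  qed (use lt' in auto)
  finally show ?thesis
    by (simp add: exp_sum sum_distrib_left)
qed

lemma (in prob_space) gaussian_quadratic_form_upper_tail:
  fixes g :: "nat \<Rightarrow> 'a \<Rightarrow> real^'n"
  assumes ind: "indep_vars (\<lambda>_. borel) g I" and fin: "finite I"
    and g: "\<And>i. i \<in> I \<Longrightarrow> std_gaussian_vector M (g i)" and q: "orthonormal_family q"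
    and N: "(\<Sum>j\<in>UNIV. \<bar>\<mu> j\<bar>) \<le> N" "0 < N" and \<epsilon>: "0 < \<epsilon>" "\<epsilon> \<le> 1"
  shows "prob {\<omega>\<in>space M. (\<Sum>i\<in>I. \<Sum>j\<in>UNIV. \<mu> j * ((q j \<bullet> g i \<omega>)\<^sup>2 - 1)) \<ge> real (card I) * \<epsilon> * N}
           \<le> exp (- real (card I) * \<epsilon>\<^sup>2 / 8)"
proof -
  define s where "s = card I"
  \<comment> \<open>The minimiser of the exponent per sample,
    \<open>- l * \<epsilon> * N + 2 * l\<^sup>2 * N\<^sup>2\<close>; the minimum is
    \<open>- \<epsilon>\<^sup>2 / 8\<close>. The assumption \<open>\<epsilon> \<le> 1\<close> keeps
    \<open>\<bar>l * \<mu> j\<bar>\<close> within \<open>1 / 4\<close>.\<close>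
  define l where "l = \<epsilon> / (4 * N)"
  have l: "l > 0" using N \<epsilon> by (simp add: l_def)
  define Y where "Y x = (\<Sum>j\<in>UNIV. \<mu> j * ((q j \<bullet> x)\<^sup>2 - 1))" for x :: "real^'n"
  have Y_meas [measurable]: "Y \<in> borel_measurable borel"
    unfolding Y_def by measurable
  have g_meas [measurable]: "g i \<in> borel_measurable M" if "i \<in> I" for i
    using ind that by (auto simp: indep_vars_def)
  have "ennreal (prob {\<omega>\<in>space M. (\<Sum>i\<in>I. Y (g i \<omega>)) \<ge> real s * \<epsilon> * N})
      = emeasure M {\<omega>\<in>space M. (\<Sum>i\<in>I. Y (g i \<omega>)) \<ge> real s * \<epsilon> * N}"
    by (simp add: emeasure_eq_measure)
  also have "\<dots> \<le> ennreal (exp (- l * (real s * \<epsilon> * N))) *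
      (\<integral>\<^sup>+\<omega>\<in>space M. ennreal (exp (l * (\<Sum>i\<in>I. Y (g i \<omega>)))) \<partial>M)"
    by (intro Chernoff_ineq_nn_integral_ge l) auto
  also have "(\<integral>\<^sup>+\<omega>\<in>space M. ennreal (exp (l * (\<Sum>i\<in>I. Y (g i \<omega>)))) \<partial>M)
      = (\<integral>\<^sup>+\<omega>. (\<Prod>i\<in>I. ennreal (exp (l * Y (g i \<omega>)))) \<partial>M)"
    by (intro nn_integral_cong) (simp add: sum_distrib_left exp_sum fin prod_ennreal)
  also have "\<dots> = (\<Prod>i\<in>I. \<integral>\<^sup>+\<omega>. ennreal (exp (l * Y (g i \<omega>))) \<partial>M)"
    by (intro indep_vars_nn_integral fin indep_vars_compose2[OF ind]) auto
  also have "\<dots> \<le> (\<Prod>i\<in>I. ennreal (exp (\<epsilon>\<^sup>2 / 8)))"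
  proof (intro prod_mono_ennreal)
    fix i assume i: "i \<in> I"
    have le: "\<bar>\<mu> j\<bar> \<le> N" for j
      using member_le_sum[of j UNIV "\<lambda>i. \<bar>\<mu> i\<bar>"] N by simp
    have "\<bar>l * \<mu> j\<bar> \<le> 1 / 4" for j
    proof -
      have "\<bar>l * \<mu> j\<bar> \<le> l * N"
        using l le[of j] by (simp add: abs_mult)
      also have "\<dots> \<le> 1 / 4"
        using N \<epsilon> by (simp add: l_def)
      finally show ?thesis .
    qed
    from std_gaussian_centered_mgf_le[OF g[OF i] q this]
    have "(\<integral>\<^sup>+\<omega>. ennreal (exp (l * Y (g i \<omega>))) \<partial>M) \<le> ennreal (exp (2 * (\<Sum>j\<in>UNIV. (l * \<mu> j)\<^sup>2)))"
      by (simp add: Y_def sum_distrib_left mult.assoc)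
    also have "\<dots> \<le> ennreal (exp (\<epsilon>\<^sup>2 / 8))"
    proof -
      \<comment> \<open>The squared Frobenius norm is bounded by the square of the trace norm, which
        is all that \<open>N\<close> controls.\<close>
      have "(\<Sum>j\<in>UNIV. (\<mu> j)\<^sup>2) \<le> (\<Sum>j\<in>UNIV. \<bar>\<mu> j\<bar> * N)"
      proof (intro sum_mono)
        fix j
        have "(\<mu> j)\<^sup>2 = \<bar>\<mu> j\<bar> * \<bar>\<mu> j\<bar>"
          by (simp add: power2_eq_square)
        also have "\<dots> \<le> \<bar>\<mu> j\<bar> * N"
          by (intro mult_left_mono le) auto
        finally show "(\<mu> j)\<^sup>2 \<le> \<bar>\<mu> j\<bar> * N" .
      qed
      also have "\<dots> \<le> N * N"
        using N by (simp add: sum_distrib_right[symmetric] mult_right_mono)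
      finally have "l\<^sup>2 * (\<Sum>j\<in>UNIV. (\<mu> j)\<^sup>2) \<le> l\<^sup>2 * (N * N)"
        by (intro mult_left_mono) auto
      also have "\<dots> = \<epsilon>\<^sup>2 / 16"
        using N by (simp add: l_def power2_eq_square)
      also have "l\<^sup>2 * (\<Sum>j\<in>UNIV. (\<mu> j)\<^sup>2) = (\<Sum>j\<in>UNIV. (l * \<mu> j)\<^sup>2)"
        by (simp add: power_mult_distrib sum_distrib_left)
      finally show ?thesis by simp
    qed
    finally show "(\<integral>\<^sup>+\<omega>. ennreal (exp (l * Y (g i \<omega>))) \<partial>M) \<le> ennreal (exp (\<epsilon>\<^sup>2 / 8))" .
  qed
  also have "\<dots> = ennreal (exp (real s * \<epsilon>\<^sup>2 / 8))"
    by (simp add: s_def ennreal_power exp_of_nat_mult[symmetric])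
  also have "ennreal (exp (- l * (real s * \<epsilon> * N))) * \<dots> = ennreal (exp (- real s * \<epsilon>\<^sup>2 / 8))"
    using N by (simp add: l_def power2_eq_square flip: ennreal_mult exp_add)
  finally show ?thesis
    by (simp add: Y_def s_def mult_left_mono)
qed

text \<open>The assumption on \<open>\<mu>\<close> does not see signs, so the lower tail is the
  upper tail for \<open>- \<mu>\<close>. The resulting factor 2 is the one in
  \<open>ln (2 / \<delta>)\<close>.\<close>

lemma (in prob_space) gaussian_quadratic_form_concentration:
  fixes g :: "nat \<Rightarrow> 'a \<Rightarrow> real^'n"
  assumes ind: "indep_vars (\<lambda>_. borel) g I" and fin: "finite I"
    and g: "\<And>i. i \<in> I \<Longrightarrow> std_gaussian_vector M (g i)" and q: "orthonormal_family q"
    and N: "(\<Sum>j\<in>UNIV. \<bar>\<mu> j\<bar>) \<le> N" "0 < N" and \<epsilon>: "0 < \<epsilon>" "\<epsilon> \<le> 1"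
  shows "prob {\<omega>\<in>space M. \<bar>\<Sum>i\<in>I. \<Sum>j\<in>UNIV. \<mu> j * ((q j \<bullet> g i \<omega>)\<^sup>2 - 1)\<bar> \<le> real (card I) * \<epsilon> * N}
           \<ge> 1 - 2 * exp (- real (card I) * \<epsilon>\<^sup>2 / 8)"
proof -
  define R where "R \<omega> = (\<Sum>i\<in>I. \<Sum>j\<in>UNIV. \<mu> j * ((q j \<bullet> g i \<omega>)\<^sup>2 - 1))" for \<omega>
  define t where "t = real (card I) * \<epsilon> * N"
  have g_meas [measurable]: "g i \<in> borel_measurable M" if "i \<in> I" for i
    using ind that by (auto simp: indep_vars_def)
  have [measurable]: "R \<in> borel_measurable M"
    unfolding R_def by measurable
  have up: "prob {\<omega>\<in>space M. R \<omega> \<ge> t} \<le> exp (- real (card I) * \<epsilon>\<^sup>2 / 8)"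
    unfolding R_def t_def by (rule gaussian_quadratic_form_upper_tail[OF assms])
  have "prob {\<omega>\<in>space M. - R \<omega> \<ge> t} \<le> exp (- real (card I) * \<epsilon>\<^sup>2 / 8)"
    using gaussian_quadratic_form_upper_tail[OF ind fin g q _ N(2) \<epsilon>, of "\<lambda>j. - \<mu> j"] N(1)
    by (simp add: R_def t_def sum_negf)
  moreover have "prob ({\<omega>\<in>space M. R \<omega> \<ge> t} \<union> {\<omega>\<in>space M. - R \<omega> \<ge> t})
      \<le> prob {\<omega>\<in>space M. R \<omega> \<ge> t} + prob {\<omega>\<in>space M. - R \<omega> \<ge> t}"
    by (rule measure_subadditive) auto
  ultimately have "prob ({\<omega>\<in>space M. R \<omega> \<ge> t} \<union> {\<omega>\<in>space M. - R \<omega> \<ge> t})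
      \<le> 2 * exp (- real (card I) * \<epsilon>\<^sup>2 / 8)"
    using up by linarith
  moreover have "prob (space M - ({\<omega>\<in>space M. R \<omega> \<ge> t} \<union> {\<omega>\<in>space M. - R \<omega> \<ge> t}))
      = 1 - prob ({\<omega>\<in>space M. R \<omega> \<ge> t} \<union> {\<omega>\<in>space M. - R \<omega> \<ge> t})"
    by (intro prob_compl) auto
  moreover have "prob (space M - ({\<omega>\<in>space M. R \<omega> \<ge> t} \<union> {\<omega>\<in>space M. - R \<omega> \<ge> t}))
      \<le> prob {\<omega>\<in>space M. \<bar>R \<omega>\<bar> \<le> t}"
    by (intro finite_measure_mono) auto
  ultimately show ?thesis
    by (simp add: R_def t_def)
qed

section \<open>Chebyshev expansion of real powers\<close>

lemma falling_factorial_pochhammer: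
  "falling_factorial a k = pochhammer (a - real k + 1) k"
proof -
  have "pochhammer (a - real k + 1) k = (\<Prod>i<k. (a - real k + 1) + real i)"
    by (simp add: pochhammer_prod atLeast0LessThan)
  also have "\<dots> = (\<Prod>i<k. (a - real k + 1) + real (k - Suc i))"
    by (rule prod.nat_diff_reindex[symmetric])
  also have "\<dots> = falling_factorial a k"
    unfolding falling_factorial_def by (intro prod.cong) (auto simp: of_nat_diff)
  finally show ?thesis by simp
qed

lemma falling_factorial_Suc: "falling_factorial a (Suc k) = falling_factorial a k * (a - real k)"
  by (simp add: falling_factorial_def)

lemma falling_factorial_shift:
  "falling_factorial (a + real k) k = pochhammer (a + 1) k"
  by (simp add: falling_factorial_pochhammer)

lemma cheb_coeff_0: "cheb_coeff \<alpha> L 0 = 2 * L powr \<alpha> * Gamma (\<alpha> + 1/2) / (sqrt pi * Gamma (\<alpha> + 1))"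
  by (simp add: cheb_coeff_def falling_factorial_def)

lemma cheb_coeff_scale: "cheb_coeff \<alpha> L k = L powr \<alpha> * cheb_coeff \<alpha> 1 k"
  by (simp add: cheb_coeff_def)

text \<open>The tail bounds and the differential equation use only this recurrence; the
  normalisation of the coefficients matters first when the constant is fixed.\<close>

lemma cheb_coeff_rec:
  assumes "\<alpha> > 0"
  shows "cheb_coeff \<alpha> L (Suc k) * (\<alpha> + real k + 1) = cheb_coeff \<alpha> L k * (\<alpha> - real k)"
proof -
  have "pochhammer (\<alpha> + 1) k > 0" "\<alpha> + 1 + real k > 0" "Gamma (\<alpha> + 1) > 0"
    using assms by (auto intro: pochhammer_pos)
  then show ?thesis
    unfolding cheb_coeff_def falling_factorial_shift pochhammer_Suc falling_factorial_Suc[of \<alpha>]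
    by (simp add: divide_simps)
qed

text \<open>From the index \<open>m\<close> on, the recurrence says that
  \<open>e k = \<bar>c k\<bar> * (k - \<alpha>)\<close> equals
  \<open>\<bar>c (Suc k)\<bar> * (\<alpha> + k + 1)\<close>. Hence
  \<open>e k - e (Suc k) = 2 * \<alpha> * \<bar>c (Suc k)\<bar>\<close>, which yields convergence
  and the bound at once.\<close>

lemma
  fixes c :: "nat \<Rightarrow> real"
  assumes \<alpha>: "\<alpha> > 0" and m: "real m \<ge> \<alpha>"
    and rec: "\<And>k. c (Suc k) * (\<alpha> + real k + 1) = c k * (\<alpha> - real k)"
  shows cheb_recurrence_tail_summable: "summable (\<lambda>n. \<bar>c (Suc m + n)\<bar>)"
    and cheb_recurrence_tail_le: "(\<Sum>n. \<bar>c (Suc m + n)\<bar>) \<le> \<bar>c m\<bar> * (real m - \<alpha>) / (2 * \<alpha>)"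
proof -
  define e where "e n = \<bar>c (m + n)\<bar> * (real (m + n) - \<alpha>)" for n
  have rec': "\<bar>c (Suc m + n)\<bar> * (\<alpha> + real (m + n) + 1) = e n" for n
  proof -
    have "\<bar>c (Suc (m + n)) * (\<alpha> + real (m + n) + 1)\<bar> = \<bar>c (m + n) * (\<alpha> - real (m + n))\<bar>"
      by (simp only: rec)
    then show ?thesis
      using m \<alpha> by (simp add: abs_mult e_def)
  qed
  have step: "\<bar>c (Suc m + n)\<bar> = (e n - e (Suc n)) / (2 * \<alpha>)" for n
  proof -
    have "e n - e (Suc n) = \<bar>c (Suc m + n)\<bar> * (2 * \<alpha>)"
      using rec'[of n] by (simp add: e_def[of "Suc n"] algebra_simps)
    then show ?thesis using \<alpha> by simp
  qed
  have e_nn: "e n \<ge> 0" for n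
    using m by (simp add: e_def)
  have partial: "(\<Sum>n<N. \<bar>c (Suc m + n)\<bar>) \<le> e 0 / (2 * \<alpha>)" for N
  proof -
    have "(\<Sum>n<N. \<bar>c (Suc m + n)\<bar>) = (e 0 - e N) / (2 * \<alpha>)"
      unfolding step by (simp add: sum_divide_distrib[symmetric] sum_lessThan_telescope')
    also have "\<dots> \<le> e 0 / (2 * \<alpha>)"
      using e_nn[of N] \<alpha> by (simp add: divide_right_mono)
    finally show ?thesis .
  qed
  show *: "summable (\<lambda>n. \<bar>c (Suc m + n)\<bar>)"
    by (rule summableI_nonneg_bounded[OF _ partial]) auto
  show "(\<Sum>n. \<bar>c (Suc m + n)\<bar>) \<le> \<bar>c m\<bar> * (real m - \<alpha>) / (2 * \<alpha>)"
    using suminf_le_const[OF * partial] by (simp add: e_def)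
qed

lemma cheb_recurrence_summable:
  fixes c :: "nat \<Rightarrow> real"
  assumes "\<alpha> > 0" and "\<And>k. c (Suc k) * (\<alpha> + real k + 1) = c k * (\<alpha> - real k)"
  shows "summable (\<lambda>n. \<bar>c n\<bar>)"
proof -
  obtain m :: nat where "real m \<ge> \<alpha>"
    using real_arch_simple by blast
  from cheb_recurrence_tail_summable[OF assms(1) this assms(2)]
  show ?thesis
    using summable_iff_shift[of "\<lambda>n. \<bar>c n\<bar>" "Suc m"] by (simp add: add.commute)
qed

text \<open>Telescoping again, now with \<open>v k = k * (k + \<alpha>) * \<bar>c k\<bar>\<close>:
  the differences are \<open>(2 * \<alpha> - 1) * k * \<bar>c k\<bar> + \<alpha> * \<bar>c
  k\<bar>\<close>, so the factor \<open>2 * \<alpha> - 1\<close> has to be positive. This is the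
  summability behind termwise differentiation.\<close>

lemma cheb_recurrence_index_summable:
  fixes c :: "nat \<Rightarrow> real"
  assumes \<alpha>: "\<alpha> > 1 / 2" and rec: "\<And>k. c (Suc k) * (\<alpha> + real k + 1) = c k * (\<alpha> - real k)"
  shows "summable (\<lambda>n. real n * \<bar>c n\<bar>)"
proof -
  obtain m :: nat where m: "real m \<ge> \<alpha>"
    using real_arch_simple by blast
  define v where "v n = real (m + n) * (real (m + n) + \<alpha>) * \<bar>c (m + n)\<bar>" for n
  have step: "real (m + n) * \<bar>c (m + n)\<bar> \<le> (v n - v (Suc n)) / (2 * \<alpha> - 1)" for n
  proof -
    have "\<bar>c (Suc (m + n)) * (\<alpha> + real (m + n) + 1)\<bar> = \<bar>c (m + n) * (\<alpha> - real (m + n))\<bar>"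
      by (simp only: rec)
    then have "\<bar>c (Suc (m + n))\<bar> * (\<alpha> + real (m + n) + 1) = \<bar>c (m + n)\<bar> * (real (m + n) - \<alpha>)"
      using m \<alpha> by (simp add: abs_mult)
    moreover have "v (Suc n) = (real (m + n) + 1) * (\<bar>c (Suc (m + n))\<bar> * (\<alpha> + real (m + n) + 1))"
      by (simp add: v_def algebra_simps)
    ultimately have "v (Suc n) = (real (m + n) + 1) * (\<bar>c (m + n)\<bar> * (real (m + n) - \<alpha>))"
      by simp
    then have "v n - v (Suc n) = (2 * \<alpha> - 1) * (real (m + n) * \<bar>c (m + n)\<bar>) + \<alpha> * \<bar>c (m + n)\<bar>"
      by (simp add: v_def algebra_simps)
    then have "(2 * \<alpha> - 1) * (real (m + n) * \<bar>c (m + n)\<bar>) \<le> v n - v (Suc n)"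
      using \<alpha> by simp
    then show ?thesis
      using \<alpha> by (simp add: pos_le_divide_eq mult.commute)
  qed
  have partial: "(\<Sum>n<N. real (m + n) * \<bar>c (m + n)\<bar>) \<le> v 0 / (2 * \<alpha> - 1)" for N
  proof -
    have "(\<Sum>n<N. real (m + n) * \<bar>c (m + n)\<bar>) \<le> (\<Sum>n<N. (v n - v (Suc n)) / (2 * \<alpha> - 1))"
      by (intro sum_mono step)
    also have "\<dots> = (v 0 - v N) / (2 * \<alpha> - 1)"
      by (simp add: sum_divide_distrib[symmetric] sum_lessThan_telescope')
    also have "\<dots> \<le> v 0 / (2 * \<alpha> - 1)"
      using \<alpha> by (intro divide_right_mono) (auto simp: v_def)
    finally show ?thesis .
  qed
  have "summable (\<lambda>n. real (m + n) * \<bar>c (m + n)\<bar>)"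
    by (rule summableI_nonneg_bounded[OF _ partial]) auto
  then show ?thesis
    using summable_iff_shift[of "\<lambda>n. real n * \<bar>c n\<bar>" m] by (simp add: add.commute)
qed

section \<open>Cosine series: calculus, differential equation and sum\<close>

text \<open>For \<open>c = cheb_coeff \<alpha> 1\<close> and
  \<open>t = arccos (2 * x / L - 1)\<close> this is the limit of
  \<open>cheb_approx \<alpha> L m x / L powr \<alpha>\<close> as \<open>m\<close> grows.\<close>

definition cosine_series :: "(nat \<Rightarrow> real) \<Rightarrow> real \<Rightarrow> real" where
  "cosine_series c t = c 0 / 2 + (\<Sum>n. c (Suc n) * cos (real (Suc n) * t))"

lemma norm_mult_trig_le:
  fixes c :: real
  shows "norm (c * cos x) \<le> \<bar>c\<bar>" and "norm (c * sin x) \<le> \<bar>c\<bar>"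
  using mult_left_mono[OF abs_cos_le_one[of x], of "\<bar>c\<bar>"] mult_left_mono[OF abs_sin_le_one[of x], of "\<bar>c\<bar>"]
  by (simp_all add: abs_mult)

lemma cosine_series_summable:
  assumes "summable (\<lambda>n. \<bar>c n\<bar>)"
  shows "summable (\<lambda>n. c (Suc n) * cos (real (Suc n) * t))"
proof (rule summable_comparison_test'[where N = 0])
  show "summable (\<lambda>n. \<bar>c (Suc n)\<bar>)"
    using assms by (subst summable_Suc_iff)
qed (rule norm_mult_trig_le)

lemma continuous_on_cosine_series:
  assumes "summable (\<lambda>n. \<bar>c n\<bar>)"
  shows "continuous_on A (cosine_series c)"
proof -
  have "summable (\<lambda>n. \<bar>c (Suc n)\<bar>)"
    using assms by (subst summable_Suc_iff)
  then have "uniform_limit A (\<lambda>N t. \<Sum>n<N. c (Suc n) * cos (real (Suc n) * t))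
      (\<lambda>t. \<Sum>n. c (Suc n) * cos (real (Suc n) * t)) sequentially"
    by (intro Weierstrass_m_test[where M = "\<lambda>n. \<bar>c (Suc n)\<bar>"]) (rule norm_mult_trig_le)
  then have "continuous_on A (\<lambda>t. \<Sum>n. c (Suc n) * cos (real (Suc n) * t))"
    by (rule uniform_limit_theorem[rotated]) (auto intro!: always_eventually continuous_intros)
  then show ?thesis
    unfolding cosine_series_def by (intro continuous_intros)
qed

lemma cosine_series_deriv:
  assumes "summable (\<lambda>n. real n * \<bar>c n\<bar>)" and c: "summable (\<lambda>n. \<bar>c n\<bar>)"
  shows "(cosine_series c has_real_derivative
           (\<Sum>n. - (real (Suc n) * c (Suc n) * sin (real (Suc n) * t)))) (at t)"
proof -
  have sm: "summable (\<lambda>n. real (Suc n) * \<bar>c (Suc n)\<bar>)"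
    using assms(1) by (subst summable_Suc_iff)
  have "uniform_limit UNIV (\<lambda>N t. \<Sum>n<N. - (real (Suc n) * c (Suc n) * sin (real (Suc n) * t)))
      (\<lambda>t. \<Sum>n. - (real (Suc n) * c (Suc n) * sin (real (Suc n) * t))) sequentially"
  proof (rule Weierstrass_m_test[OF _ sm])
    fix n t
    show "norm (- (real (Suc n) * c (Suc n) * sin (real (Suc n) * t))) \<le> real (Suc n) * \<bar>c (Suc n)\<bar>"
      using norm_mult_trig_le(2)[of "real (Suc n) * c (Suc n)" "real (Suc n) * t"]
      by (simp add: abs_mult)
  qed
  then have uc: "uniformly_convergent_on UNIV (\<lambda>N t. \<Sum>n<N. - (real (Suc n) * c (Suc n) * sin (real (Suc n) * t)))"
    by (auto simp: uniformly_convergent_on_def)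
  have "((\<lambda>t. \<Sum>n. c (Suc n) * cos (real (Suc n) * t)) has_real_derivative
          (\<Sum>n. - (real (Suc n) * c (Suc n) * sin (real (Suc n) * t)))) (at t)"
  proof (rule has_field_derivative_series'(2)[where S = UNIV and ?x0.0 = 0
        and f = "\<lambda>n t. c (Suc n) * cos (real (Suc n) * t)"
        and f' = "\<lambda>n t. - (real (Suc n) * c (Suc n) * sin (real (Suc n) * t))"])
    show "((\<lambda>t. c (Suc n) * cos (real (Suc n) * t)) has_real_derivative
            - (real (Suc n) * c (Suc n) * sin (real (Suc n) * x))) (at x)" for n x
      by (auto intro!: derivative_eq_intros simp del: of_nat_Suc)
  qed (use uc cosine_series_summable[OF c, of 0] in auto)
  then show ?thesis
    unfolding cosine_series_def[abs_def] by (auto intro!: derivative_eq_intros)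
qed

text \<open>All the sines vanish at 0 and at \<open>pi\<close>, so integrating the series over
  \<open>{0..pi}\<close> isolates \<open>c 0\<close>.\<close>

lemma cosine_series_antideriv:
  assumes c: "summable (\<lambda>n. \<bar>c n\<bar>)"
  shows "((\<lambda>t. c 0 / 2 * t + (\<Sum>n. c (Suc n) / real (Suc n) * sin (real (Suc n) * t)))
           has_real_derivative cosine_series c t) (at t)"
proof -
  have sm: "summable (\<lambda>n. \<bar>c (Suc n)\<bar>)"
    using c by (subst summable_Suc_iff)
  have "uniform_limit UNIV (\<lambda>N t. \<Sum>n<N. c (Suc n) * cos (real (Suc n) * t))
      (\<lambda>t. \<Sum>n. c (Suc n) * cos (real (Suc n) * t)) sequentially"
    by (rule Weierstrass_m_test[OF _ sm]) (rule norm_mult_trig_le)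
  then have uc: "uniformly_convergent_on UNIV (\<lambda>N t. \<Sum>n<N. c (Suc n) * cos (real (Suc n) * t))"
    by (auto simp: uniformly_convergent_on_def)
  have "((\<lambda>t. \<Sum>n. c (Suc n) / real (Suc n) * sin (real (Suc n) * t)) has_real_derivative
          (\<Sum>n. c (Suc n) * cos (real (Suc n) * t))) (at t)"
  proof (rule has_field_derivative_series'(2)[where S = UNIV and ?x0.0 = 0
        and f = "\<lambda>n t. c (Suc n) / real (Suc n) * sin (real (Suc n) * t)"
        and f' = "\<lambda>n t. c (Suc n) * cos (real (Suc n) * t)"])
    show "((\<lambda>t. c (Suc n) / real (Suc n) * sin (real (Suc n) * t)) has_real_derivative
            c (Suc n) * cos (real (Suc n) * x)) (at x)" for n x
      by (auto intro!: derivative_eq_intros simp del: of_nat_Suc)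
  qed (use uc in auto)
  then show ?thesis
    unfolding cosine_series_def by (auto intro!: derivative_eq_intros)
qed

text \<open>The recurrence of the coefficients makes the difference of the two sides telescope.\<close>

lemma cosine_series_ode:
  assumes \<alpha>: "\<alpha> > 1 / 2" and rec: "\<And>k. c (Suc k) * (\<alpha> + real k + 1) = c k * (\<alpha> - real k)"
  shows "(\<Sum>n. - (real (Suc n) * c (Suc n) * sin (real (Suc n) * t))) * cos (t / 2)
           = - \<alpha> * sin (t / 2) * cosine_series c t"
proof -
  have sm1: "summable (\<lambda>n. real n * \<bar>c n\<bar>)"
    by (rule cheb_recurrence_index_summable[OF \<alpha> rec])
  have sm0: "summable (\<lambda>n. \<bar>c n\<bar>)"
    using \<alpha> by (intro cheb_recurrence_summable[OF _ rec]) auto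
  define p where "p n = - (real (Suc n) * c (Suc n) * sin (real (Suc n) * t))" for n
  define r where "r n = c (Suc n) * cos (real (Suc n) * t)" for n
  define w where "w n = c n * (\<alpha> - real n) * sin (real n * t + t / 2)" for n
  have p: "summable p"
  proof (rule summable_comparison_test'[where N = 0])
    show "summable (\<lambda>n. real (Suc n) * \<bar>c (Suc n)\<bar>)"
      using sm1 by (subst summable_Suc_iff)
    show "norm (p n) \<le> real (Suc n) * \<bar>c (Suc n)\<bar>" for n
      using norm_mult_trig_le(2)[of "real (Suc n) * c (Suc n)" "real (Suc n) * t"]
      by (simp add: abs_mult p_def)
  qed
  have r: "summable r"
    unfolding r_def by (rule cosine_series_summable[OF sm0])
  have "w \<longlonglongrightarrow> 0"
  proof (rule Lim_null_comparison[where g = "\<lambda>n. \<alpha> * \<bar>c n\<bar> + real n * \<bar>c n\<bar>"])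
    have "\<bar>w n\<bar> \<le> \<alpha> * \<bar>c n\<bar> + real n * \<bar>c n\<bar>" for n
    proof -
      have "\<bar>w n\<bar> \<le> \<bar>c n * (\<alpha> - real n)\<bar>"
        using norm_mult_trig_le(2) by (simp add: w_def)
      also have "\<dots> \<le> \<bar>c n\<bar> * (\<alpha> + real n)"
        using \<alpha> by (simp add: abs_mult mult_left_mono)
      finally show ?thesis by (simp add: algebra_simps)
    qed
    then show "\<forall>\<^sub>F n in sequentially. norm (w n) \<le> \<alpha> * \<bar>c n\<bar> + real n * \<bar>c n\<bar>"
      by simp
    show "(\<lambda>n. \<alpha> * \<bar>c n\<bar> + real n * \<bar>c n\<bar>) \<longlonglongrightarrow> 0"
      using tendsto_add[OF tendsto_mult_left[OF summable_LIMSEQ_zero[OF sm0], of \<alpha>]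
          summable_LIMSEQ_zero[OF sm1]] by simp
  qed
  then have "(\<lambda>n. w (Suc n) - w n) sums (0 - w 0)"
    by (rule telescope_sums)
  moreover have "w (Suc n) - w n = 2 * (p n * cos (t / 2) + \<alpha> * sin (t / 2) * r n)" for n
  proof -
    define u where "u = real (Suc n) * t"
    have "real n * t + t / 2 = u - t / 2"
      by (simp add: u_def algebra_simps)
    \<comment> \<open>The recurrence expresses \<open>w n\<close> through \<open>c (Suc n)\<close>,
      so that \<open>w n\<close> and \<open>w (Suc n)\<close> differ only in the factor and in the
      sign of the half angle around \<open>u\<close>.\<close>
    then have w1: "w n = c (Suc n) * (\<alpha> + real n + 1) * sin (u - t / 2)"
      by (simp only: w_def rec)
    have w2: "w (Suc n) = c (Suc n) * (\<alpha> - real n - 1) * sin (u + t / 2)"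
      by (simp add: w_def u_def)
    have pr: "p n = - ((real n + 1) * c (Suc n) * sin u)" "r n = c (Suc n) * cos u"
      by (simp_all add: p_def r_def u_def)
    show ?thesis
      unfolding w1 w2 pr sin_add sin_diff by (simp add: algebra_simps)
  qed
  moreover have "(\<lambda>n. 2 * (p n * cos (t / 2) + \<alpha> * sin (t / 2) * r n)) sums
      (2 * (suminf p * cos (t / 2) + \<alpha> * sin (t / 2) * suminf r))"
    by (intro sums_mult sums_add sums_mult2 summable_sums p r)
  \<comment> \<open>The boundary value \<open>- w 0 = - \<alpha> * c 0 * sin (t / 2)\<close>
    supplies the constant term \<open>c 0 / 2\<close> of the series.\<close>
  ultimately have "2 * (suminf p * cos (t / 2) + \<alpha> * sin (t / 2) * suminf r) = - w 0"
    by (simp add: sums_unique2)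
  then show ?thesis
    by (simp add: w_def cosine_series_def p_def[abs_def] r_def[abs_def] algebra_simps)
qed

lemma cosine_series_eq_const_powr:
  assumes \<alpha>: "\<alpha> > 1 / 2" and rec: "\<And>k. c (Suc k) * (\<alpha> + real k + 1) = c k * (\<alpha> - real k)"
    and t: "0 \<le> t" "t < pi"
  shows "cosine_series c t = cosine_series c 0 * cos (t / 2) powr (2 * \<alpha>)"
proof -
  have sm1: "summable (\<lambda>n. real n * \<bar>c n\<bar>)"
    by (rule cheb_recurrence_index_summable[OF \<alpha> rec])
  have sm0: "summable (\<lambda>n. \<bar>c n\<bar>)"
    using \<alpha> by (intro cheb_recurrence_summable[OF _ rec]) auto
  \<comment> \<open>The quotient of the series by the expected power of the cosine. It makes sense
    only while \<open>cos (u / 2)\<close> is positive, hence the restriction to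
    \<open>t < pi\<close>.\<close>
  define F where "F u = cosine_series c u * cos (u / 2) powr (- 2 * \<alpha>)" for u
  have cos_pos: "cos (u / 2) > 0" if "0 \<le> u" "u \<le> t" for u
    using that t by (intro cos_gt_zero_pi) auto
  have "(F has_real_derivative 0) (at u within {0..t})" if u: "0 \<le> u" "u \<le> t" for u
  proof -
    define S' where "S' = (\<Sum>n. - (real (Suc n) * c (Suc n) * sin (real (Suc n) * u)))"
    have "(F has_real_derivative (S' * cos (u / 2) powr (- 2 * \<alpha>) +
        cosine_series c u * ((- 2 * \<alpha>) * cos (u / 2) powr (- 2 * \<alpha> - 1) * (- sin (u / 2) / 2)))) (at u)"
      unfolding F_def S'_def using cos_pos[OF u]
      by (auto intro!: derivative_eq_intros cosine_series_deriv[OF sm1 sm0] simp: field_simps)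
    also have "cos (u / 2) powr (- 2 * \<alpha>) = cos (u / 2) powr (- 2 * \<alpha> - 1) * cos (u / 2)"
      using cos_pos[OF u] by (simp add: powr_diff)
    also have "S' * (cos (u / 2) powr (- 2 * \<alpha> - 1) * cos (u / 2)) +
        cosine_series c u * ((- 2 * \<alpha>) * cos (u / 2) powr (- 2 * \<alpha> - 1) * (- sin (u / 2) / 2))
        = cos (u / 2) powr (- 2 * \<alpha> - 1) * (S' * cos (u / 2) + \<alpha> * sin (u / 2) * cosine_series c u)"
      by (simp add: algebra_simps)
    also have "\<dots> = 0"
      unfolding S'_def cosine_series_ode[OF \<alpha> rec] by simp
    finally show ?thesis
      by (rule has_field_derivative_at_within)
  qed
  then have "\<exists>k. \<forall>u\<in>{0..t}. F u = k"
    by (intro has_field_derivative_zero_constant) auto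
  then have "F t = F 0"
    using t(1) by force
  then have "cosine_series c t * cos (t / 2) powr (- 2 * \<alpha>) = cosine_series c 0"
    by (simp add: F_def)
  then show ?thesis
    using cos_pos[of t] t by (simp add: powr_minus field_simps)
qed

text \<open>The value \<open>C\<close> at 0 is not summed directly. Integrating the series over
  \<open>{0..pi}\<close> gives \<open>c 0 * pi / 2\<close>, and integrating
  \<open>C * cos (t / 2) powr (2 * \<alpha>)\<close> gives \<open>C\<close> times a Beta value;
  \<open>c 0\<close> is normalised so that the two agree for \<open>C = 1\<close>.\<close>

lemma cosine_series_at_0:
  assumes \<alpha>: "\<alpha> > 1 / 2"
  shows "cosine_series (cheb_coeff \<alpha> 1) 0 = 1"
proof -
  define c where "c = cheb_coeff \<alpha> 1"
  have rec: "c (Suc k) * (\<alpha> + real k + 1) = c k * (\<alpha> - real k)" for k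
    unfolding c_def using \<alpha> by (intro cheb_coeff_rec) auto
  have sm0: "summable (\<lambda>n. \<bar>c n\<bar>)"
    using \<alpha> by (intro cheb_recurrence_summable[OF _ rec]) auto
  define C where "C = cosine_series c 0"
  define H where "H t = c 0 / 2 * t + (\<Sum>n. c (Suc n) / real (Suc n) * sin (real (Suc n) * t))" for t
  define \<beta> where "\<beta> = (\<lambda>t::real. t powr (\<alpha> + 1/2 - 1) * (1 - t) powr (1/2 - 1))"
  define I where "I x = integral {0..x} \<beta>" for x
  define J where "J t = I ((cos (t / 2))\<^sup>2)" for t
  have beta: "(\<beta> has_integral Beta (\<alpha> + 1/2) (1/2)) {0..1}"
    unfolding \<beta>_def using \<alpha> by (intro has_integral_Beta_real) auto
  have I_cont: "continuous_on {0..1} I"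
    unfolding I_def using beta by (intro indefinite_integral_continuous_1) (auto simp: integrable_on_def)
  have I_der: "(I has_real_derivative \<beta> x) (at x)" if x: "0 < x" "x < 1" for x
  proof -
    have "continuous_on {0<..<1} \<beta>"
      unfolding \<beta>_def by (auto intro!: continuous_intros)
    then have cont: "continuous (at x within {0..1}) \<beta>"
      using x by (auto simp: continuous_on_eq_continuous_at intro: continuous_at_imp_continuous_at_within)
    have "(I has_vector_derivative \<beta> x) (at x within {0..1})"
      unfolding I_def using x beta cont integral_has_vector_derivative_continuous_at[of \<beta> 0 1 x "{}"]
      by (auto simp: integrable_on_def)
    then show ?thesis
      using x at_within_Icc_at[of 0 x 1] by (simp add: has_real_derivative_iff_has_vector_derivative)
  qed
  \<comment> \<open>The substitution \<open>x = (cos (t / 2))\<^sup>2\<close> sends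
    \<open>t = 0\<close> to the singularity of \<open>\<beta>\<close> at 1. Constancy of
    \<open>H + C * J\<close> needs derivatives only inside the interval and continuity at its
    ends.\<close>
  have "H pi + C * J pi = H 0 + C * J 0"
  proof (rule DERIV_isconst2[of 0 pi "\<lambda>t. H t + C * J t" pi])
    have "continuous_on {0..pi} H"
      unfolding H_def
      using cosine_series_antideriv[OF sm0] by (meson DERIV_isCont continuous_at_imp_continuous_on)
    moreover have "continuous_on {0..pi} J"
      unfolding J_def
      by (rule continuous_on_compose2[OF I_cont]) (auto intro!: continuous_intros simp: abs_square_le_1)
    ultimately show "continuous_on {0..pi} (\<lambda>t. H t + C * J t)"
      by (intro continuous_intros)
    fix t :: real assume t: "0 < t" "t < pi"
    have cpos: "cos (t / 2) > 0" and spos: "sin (t / 2) > 0"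
      using t by (auto intro!: cos_gt_zero_pi sin_gt_zero)
    have s_eq: "1 - (cos (t / 2))\<^sup>2 = (sin (t / 2))\<^sup>2"
      using sin_cos_squared_add[of "t / 2"] by linarith
    then have c1: "(cos (t / 2))\<^sup>2 < 1"
      using zero_less_power[OF spos, of 2] by linarith
    have "(J has_real_derivative \<beta> ((cos (t / 2))\<^sup>2) * (- (cos (t / 2) * sin (t / 2)))) (at t)"
      unfolding J_def
      by (rule DERIV_chain2[OF I_der]) (use cpos c1 in \<open>auto intro!: derivative_eq_intros\<close>)
    also have "\<beta> ((cos (t / 2))\<^sup>2) * (- (cos (t / 2) * sin (t / 2))) = - (cos (t / 2) powr (2 * \<alpha>))"
    proof -
      have "((cos (t / 2))\<^sup>2) powr (\<alpha> + 1/2 - 1) = cos (t / 2) powr (2 * \<alpha>) / cos (t / 2)"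
      proof -
        have "((cos (t / 2))\<^sup>2) powr (\<alpha> + 1/2 - 1) = cos (t / 2) powr (2 * \<alpha> - 1)"
          using cpos by (simp flip: powr_numeral add: powr_powr algebra_simps)
        then show ?thesis using cpos by (simp add: powr_diff)
      qed
      moreover have "((sin (t / 2))\<^sup>2) powr (1/2 - 1) = 1 / sin (t / 2)"
      proof -
        have "((sin (t / 2))\<^sup>2) powr (1/2 - 1) = sin (t / 2) powr (- 1)"
          using spos by (simp flip: powr_numeral add: powr_powr)
        then show ?thesis using spos by (simp add: powr_minus_divide)
      qed
      ultimately show ?thesis
        using cpos spos by (simp add: \<beta>_def s_eq)
    qed
    finally have Jd: "(J has_real_derivative - (cos (t / 2) powr (2 * \<alpha>))) (at t)" .
    have Hd: "(H has_real_derivative C * cos (t / 2) powr (2 * \<alpha>)) (at t)"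
      using cosine_series_antideriv[OF sm0, of t] cosine_series_eq_const_powr[OF \<alpha> rec, of t] t
      unfolding H_def C_def by simp
    show "((\<lambda>t. H t + C * J t) has_real_derivative 0) (at t)"
      by (rule derivative_eq_intros Hd Jd refl)+ simp
  qed auto
  moreover have "H pi = c 0 / 2 * pi" "H 0 = 0"
  proof -
    have "sin (real (Suc n) * pi) = 0" for n by (rule sin_npi)
    then show "H pi = c 0 / 2 * pi" "H 0 = 0"
      unfolding H_def by (simp_all del: of_nat_Suc)
  qed
  moreover have "J pi = 0" "J 0 = Beta (\<alpha> + 1/2) (1/2)"
    using beta by (simp_all add: J_def I_def integral_unique)
  ultimately have "c 0 / 2 * pi = C * Beta (\<alpha> + 1/2) (1/2)"
    by simp
  moreover have "Beta (\<alpha> + 1/2) (1/2) = Gamma (\<alpha> + 1/2) * sqrt pi / Gamma (\<alpha> + 1)"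
    by (simp add: Beta_def Gamma_one_half_real add.commute)
  moreover have "c 0 / 2 * pi = Gamma (\<alpha> + 1/2) * sqrt pi / Gamma (\<alpha> + 1)"
  proof -
    have "c 0 / 2 * pi = Gamma (\<alpha> + 1/2) * (pi / sqrt pi) / Gamma (\<alpha> + 1)"
      by (simp add: c_def cheb_coeff_0)
    then show ?thesis
      by (simp only: real_div_sqrt[OF pi_ge_zero])
  qed
  moreover have "Gamma (\<alpha> + 1/2) > 0" "Gamma (\<alpha> + 1) > 0"
    using \<alpha> by (auto intro: Gamma_real_pos)
  ultimately show ?thesis
    by (simp add: C_def c_def)
qed

lemma cosine_series_cheb_coeff_gt_half:
  assumes "\<alpha> > 1 / 2" "0 \<le> t" "t < pi"
  shows "cosine_series (cheb_coeff \<alpha> 1) t = cos (t / 2) powr (2 * \<alpha>)"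
  using cosine_series_eq_const_powr[of \<alpha> "cheb_coeff \<alpha> 1" t] cheb_coeff_rec[of \<alpha> 1]
    cosine_series_at_0[OF assms(1)] assms by simp

section \<open>Passing from the exponent \<alpha> to \<alpha> + 1\<close>

text \<open>Both coefficient sequences obey first-order recurrences, so their ratio propagates by
  induction from \<open>k = 0\<close>, where it comes from the functional equation of
  \<open>Gamma\<close>. Non-integrality keeps every factor \<open>\<alpha> - k\<close> away from
  zero.\<close>

lemma cheb_coeff_plus_1:
  assumes \<alpha>: "\<alpha> > 0" "\<alpha> \<notin> \<int>"
  shows "cheb_coeff (\<alpha> + 1) 1 k =
           cheb_coeff \<alpha> 1 k * (2 * \<alpha> + 1) * (\<alpha> + 1) / (2 * (\<alpha> + 1 - real k) * (\<alpha> + 1 + real k))"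
proof (induction k)
  case 0
  have "\<alpha> + 1/2 \<notin> \<int>\<^sub>\<le>\<^sub>0" "\<alpha> + 1 \<notin> \<int>\<^sub>\<le>\<^sub>0"
    using \<alpha>(1) nonpos_Ints_nonpos[of "\<alpha> + 1/2"] nonpos_Ints_nonpos[of "\<alpha> + 1"] by auto
  then have "Gamma (\<alpha> + 1 + 1/2) = (\<alpha> + 1/2) * Gamma (\<alpha> + 1/2)"
    using Gamma_plus1[of "\<alpha> + 1/2"] \<alpha> by (simp add: algebra_simps)
  moreover from \<open>\<alpha> + 1 \<notin> \<int>\<^sub>\<le>\<^sub>0\<close> have "Gamma (\<alpha> + 1 + 1) = (\<alpha> + 1) * Gamma (\<alpha> + 1)"
    using Gamma_plus1[of "\<alpha> + 1"] \<alpha> by (simp add: algebra_simps)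
  moreover have "Gamma (\<alpha> + 1) > 0"
    using \<alpha> by (intro Gamma_real_pos) auto
  ultimately show ?case
    using \<alpha> unfolding cheb_coeff_0
    by (simp add: divide_simps add_eq_0_iff2) (simp add: algebra_simps)
next
  case (Suc k)
  have nz: "\<alpha> - real n \<noteq> 0" for n
    using \<alpha>(2) by (metis Ints_of_nat eq_iff_diff_eq_0)
  have nz1: "\<alpha> + 1 - real k \<noteq> 0"
  proof
    assume "\<alpha> + 1 - real k = 0"
    then have "\<alpha> = real_of_int (int k - 1)" by simp
    then show False using \<alpha>(2) by (metis Ints_of_int)
  qed
  have pos: "\<alpha> + 1 + real k > 0" "\<alpha> + 2 + real k > 0" using \<alpha> by auto
  define c where "c = cheb_coeff \<alpha> 1"
  have ck: "c k = c (Suc k) * (\<alpha> + 1 + real k) / (\<alpha> - real k)"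
    using cheb_coeff_rec[OF \<alpha>(1), of 1 k] nz[of k] by (simp add: c_def field_simps)
  have "cheb_coeff (\<alpha> + 1) 1 (Suc k) * (\<alpha> + 2 + real k) = cheb_coeff (\<alpha> + 1) 1 k * (\<alpha> + 1 - real k)"
    using cheb_coeff_rec[of "\<alpha> + 1" 1 k] \<alpha> by (simp add: algebra_simps)
  also have "\<dots> = c (Suc k) * (2 * \<alpha> + 1) * (\<alpha> + 1) / (2 * (\<alpha> - real k))"
    unfolding Suc c_def[symmetric] ck using nz1 pos nz[of k]
    by (simp add: divide_simps) (simp add: algebra_simps)?
  finally have "cheb_coeff (\<alpha> + 1) 1 (Suc k) =
      c (Suc k) * (2 * \<alpha> + 1) * (\<alpha> + 1) / (2 * (\<alpha> - real k)) / (\<alpha> + 2 + real k)"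
    using pos by (subst nonzero_eq_divide_eq) auto
  moreover have "2 * (\<alpha> + 1 - real (Suc k)) * (\<alpha> + 1 + real (Suc k)) = (2 * (\<alpha> - real k)) * (\<alpha> + 2 + real k)"
    by (simp add: algebra_simps)
  ultimately show ?case
    by (simp only: c_def divide_divide_eq_left)
qed

text \<open>The coefficient form of multiplication by \<open>(1 + cos t) / 2\<close>: the factor
  \<open>cos t\<close> averages the two neighbouring coefficients.\<close>

lemma cheb_coeff_plus_1_Suc:
  assumes \<alpha>: "\<alpha> > 0" "\<alpha> \<notin> \<int>"
  shows "cheb_coeff (\<alpha> + 1) 1 (Suc k) =
           cheb_coeff \<alpha> 1 (Suc k) / 2 + (cheb_coeff \<alpha> 1 k + cheb_coeff \<alpha> 1 (Suc (Suc k))) / 4"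
proof -
  have nz: "\<alpha> - real n \<noteq> 0" for n
    using \<alpha>(2) by (metis Ints_of_nat eq_iff_diff_eq_0)
  define c where "c = cheb_coeff \<alpha> 1"
  have pos: "\<alpha> + 1 + real k > 0" "\<alpha> + 2 + real k > 0" using \<alpha> by auto
  have c1: "c k = c (Suc k) * (\<alpha> + 1 + real k) / (\<alpha> - real k)"
    using cheb_coeff_rec[OF \<alpha>(1), of 1 k] nz[of k] by (simp add: c_def field_simps)
  have c2: "c (Suc (Suc k)) = c (Suc k) * (\<alpha> - 1 - real k) / (\<alpha> + 2 + real k)"
    using cheb_coeff_rec[OF \<alpha>(1), of 1 "Suc k"] pos by (simp add: c_def field_simps)
  have "cheb_coeff (\<alpha> + 1) 1 (Suc k) =
      c (Suc k) * (2 * \<alpha> + 1) * (\<alpha> + 1) / (2 * (\<alpha> - real k) * (\<alpha> + 2 + real k))"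
  proof -
    have "2 * (\<alpha> + 1 - real (Suc k)) * (\<alpha> + 1 + real (Suc k)) = 2 * (\<alpha> - real k) * (\<alpha> + 2 + real k)"
      by (simp add: algebra_simps)
    then show ?thesis
      by (simp only: cheb_coeff_plus_1[OF assms] c_def)
  qed
  also have "\<dots> = c (Suc k) / 2 + (c k + c (Suc (Suc k))) / 4"
    using nz[of k] pos unfolding c1 c2 by (simp add: divide_simps) (simp add: algebra_simps)
  finally show ?thesis by (simp add: c_def)
qed

text \<open>At index 0 the neighbour on the left is the mirror image of \<open>c 1\<close>, which
  therefore counts twice.\<close>

lemma cheb_coeff_plus_1_0:
  assumes \<alpha>: "\<alpha> > 0" "\<alpha> \<notin> \<int>"
  shows "cheb_coeff (\<alpha> + 1) 1 0 = cheb_coeff \<alpha> 1 0 / 2 + cheb_coeff \<alpha> 1 1 / 2"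
proof -
  have "cheb_coeff \<alpha> 1 1 = cheb_coeff \<alpha> 1 0 * \<alpha> / (\<alpha> + 1)"
    using cheb_coeff_rec[OF \<alpha>(1), of 1 0] \<alpha> by (simp add: field_simps)
  then show ?thesis
    using \<alpha> unfolding cheb_coeff_plus_1[OF assms]
    by (simp add: divide_simps add_eq_0_iff2 flip: distrib_left distrib_right) (simp add: algebra_simps)
qed

text \<open>Multiplication by \<open>(cos (t / 2))\<^sup>2\<close> raises the exponent, so that small \<open>\<alpha>\<close>, for which the
  differentiated series need not converge, reduce to the case above.\<close>

lemma cosine_series_plus_1:
  assumes \<alpha>: "\<alpha> > 0" "\<alpha> \<notin> \<int>"
  shows "cosine_series (cheb_coeff (\<alpha> + 1) 1) t = cosine_series (cheb_coeff \<alpha> 1) t * (cos (t / 2))\<^sup>2"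
proof -
  define c where "c = cheb_coeff \<alpha> 1"
  define e where "e = cheb_coeff (\<alpha> + 1) 1"
  have c: "summable (\<lambda>n. \<bar>c n\<bar>)" and e: "summable (\<lambda>n. \<bar>e n\<bar>)"
  proof -
    show "summable (\<lambda>n. \<bar>c n\<bar>)"
      unfolding c_def by (rule cheb_recurrence_summable[OF \<alpha>(1) cheb_coeff_rec[OF \<alpha>(1)]])
    have "\<alpha> + 1 > 0" using \<alpha> by simp
    from cheb_recurrence_summable[OF this cheb_coeff_rec[OF this]] show "summable (\<lambda>n. \<bar>e n\<bar>)"
      unfolding e_def .
  qed
  have c0: "(\<lambda>n. \<bar>c n\<bar>) \<longlonglongrightarrow> 0"
    by (rule summable_LIMSEQ_zero[OF c])
  \<comment> \<open>The boundary terms of the two index shifts caused by \<open>cos t\<close>;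
    comparing the series term by term telescopes through \<open>r\<close>.\<close>
  define r where "r n = c (Suc n) * cos (real n * t) / 4 - c n * cos (real (Suc n) * t) / 4" for n
  have "(\<lambda>n. c (Suc n) * cos (real n * t)) \<longlonglongrightarrow> 0"
    by (rule Lim_null_comparison[OF always_eventually LIMSEQ_Suc[OF c0]]) (intro allI norm_mult_trig_le(1))
  moreover have "(\<lambda>n. c n * cos (real (Suc n) * t)) \<longlonglongrightarrow> 0"
    by (rule Lim_null_comparison[OF always_eventually c0]) (intro allI norm_mult_trig_le(1))
  ultimately have "r \<longlonglongrightarrow> 0 / 4 - 0 / 4"
    unfolding r_def by (intro tendsto_intros) auto
  then have "(\<lambda>n. r (Suc n) - r n) sums (0 - r 0)"
    by (intro telescope_sums) simp
  moreover have "r (Suc n) - r n = e (Suc n) * cos (real (Suc n) * t)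
      - c (Suc n) * cos (real (Suc n) * t) * ((1 + cos t) / 2)" for n
  proof -
    define u where "u = real (Suc n) * t"
    have u: "real n * t = u - t" "real (Suc (Suc n)) * t = u + t" "real (Suc n) * t = u"
      by (simp_all add: u_def algebra_simps)
    have r1: "r (Suc n) = c (Suc (Suc n)) * cos u / 4 - c (Suc n) * cos (u + t) / 4"
      and r2: "r n = c (Suc n) * cos (u - t) / 4 - c n * cos u / 4"
      by (simp_all only: r_def u)
    have e1: "e (Suc n) = c (Suc n) / 2 + (c n + c (Suc (Suc n))) / 4"
      unfolding e_def c_def by (rule cheb_coeff_plus_1_Suc[OF \<alpha>])
    show ?thesis
      unfolding r1 r2 e1 u cos_add cos_diff by (simp add: field_simps)
  qed
  moreover have "(\<lambda>n. e (Suc n) * cos (real (Suc n) * t)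
      - c (Suc n) * cos (real (Suc n) * t) * ((1 + cos t) / 2)) sums
      ((\<Sum>n. e (Suc n) * cos (real (Suc n) * t)) - (\<Sum>n. c (Suc n) * cos (real (Suc n) * t)) * ((1 + cos t) / 2))"
    by (intro sums_diff sums_mult2 summable_sums cosine_series_summable c e)
  ultimately have "(\<Sum>n. e (Suc n) * cos (real (Suc n) * t))
      - (\<Sum>n. c (Suc n) * cos (real (Suc n) * t)) * ((1 + cos t) / 2) = - r 0"
    by (simp add: sums_unique2)
  then have sum_e: "(\<Sum>n. e (Suc n) * cos (real (Suc n) * t))
      = (\<Sum>n. c (Suc n) * cos (real (Suc n) * t)) * ((1 + cos t) / 2) - (c 1 / 4 - c 0 * cos t / 4)"
    by (simp add: r_def)
  have e0: "e 0 = c 0 / 2 + c 1 / 2"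
    unfolding e_def c_def by (rule cheb_coeff_plus_1_0[OF \<alpha>])
  have half: "(cos (t / 2))\<^sup>2 = (1 + cos t) / 2"
    using cos_double_cos[of "t / 2"] by simp
  show ?thesis
    unfolding c_def[symmetric] e_def[symmetric] cosine_series_def sum_e e0 half
    by (simp add: field_simps)
qed

text \<open>For \<open>t < pi\<close> the factor \<open>(cos (t / 2))\<^sup>2\<close> can be
  cancelled. The point \<open>t = pi\<close> corresponds to the eigenvalue 0 and is reached by
  continuity.\<close>

theorem cosine_series_cheb_coeff:
  assumes \<alpha>: "\<alpha> > 0" "\<alpha> \<notin> \<int>" and t: "0 \<le> t" "t \<le> pi"
  shows "cosine_series (cheb_coeff \<alpha> 1) t = cos (t / 2) powr (2 * \<alpha>)"
proof -
  have lt: "cosine_series (cheb_coeff \<alpha> 1) u - cos (u / 2) powr (2 * \<alpha>) = 0" if u: "u \<in> {0..<pi}" for u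
  proof -
    have cpos: "cos (u / 2) > 0"
      using u by (intro cos_gt_zero_pi) auto
    have "cosine_series (cheb_coeff \<alpha> 1) u * (cos (u / 2))\<^sup>2 = cos (u / 2) powr (2 * (\<alpha> + 1))"
      using cosine_series_cheb_coeff_gt_half[of "\<alpha> + 1" u] \<alpha> u by (simp add: cosine_series_plus_1)
    also have "\<dots> = cos (u / 2) powr (2 * \<alpha>) * (cos (u / 2))\<^sup>2"
      using cpos by (simp add: distrib_left powr_add)
    finally show ?thesis
      using cpos by simp
  qed
  have cl: "closure {0..<pi} = {0..pi}"
    by simp
  have "continuous_on {0..pi} (cosine_series (cheb_coeff \<alpha> 1))"
    using \<alpha> by (intro continuous_on_cosine_series cheb_recurrence_summable[OF _ cheb_coeff_rec])
  moreover have "continuous_on {0..pi} (\<lambda>u. cos (u / 2) powr (2 * \<alpha>))"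
    using \<alpha> by (intro continuous_on_powr' continuous_intros) (auto intro!: cos_ge_zero)
  ultimately have "continuous_on (closure {0..<pi}) (\<lambda>u. cosine_series (cheb_coeff \<alpha> 1) u - cos (u / 2) powr (2 * \<alpha>))"
    unfolding cl by (rule continuous_on_diff)
  from continuous_constant_on_closure[OF this lt, of t] show ?thesis
    using t by (simp add: cl)
qed

lemma cheb_approx_error_le:
  assumes \<alpha>: "\<alpha> > 0" "\<alpha> \<notin> \<int>" and m: "real m \<ge> \<alpha>" and x: "0 \<le> x" "x \<le> L" and L: "L > 0"
  shows "\<bar>cheb_approx \<alpha> L m x - x powr \<alpha>\<bar> \<le> \<bar>cheb_coeff \<alpha> L m\<bar> * (real m - \<alpha>) / (2 * \<alpha>)"
proof -
  define t where "t = arccos (2 * x / L - 1)"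
  have range: "- 1 \<le> 2 * x / L - 1" "2 * x / L - 1 \<le> 1"
    using x L by (auto simp: field_simps)
  have t: "0 \<le> t" "t \<le> pi" and cos_t: "cos t = 2 * x / L - 1"
    unfolding t_def using range by (auto intro: arccos_lbound arccos_ubound)
  define c where "c = cheb_coeff \<alpha> 1"
  have sm: "summable (\<lambda>n. \<bar>c n\<bar>)"
    unfolding c_def using \<alpha> by (intro cheb_recurrence_summable[OF _ cheb_coeff_rec])
  have "(cos (t / 2))\<^sup>2 = x / L"
    using cos_double_cos[of "t / 2"] cos_t by simp
  moreover have "cos (t / 2) \<ge> 0"
    using t by (intro cos_ge_zero) auto
  ultimately have "cos (t / 2) = sqrt (x / L)"
    by (metis real_sqrt_unique)
  then have "cos (t / 2) powr (2 * \<alpha>) = (x / L) powr \<alpha>"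
    using x L by (simp add: powr_half_sqrt[symmetric] powr_powr)
  then have "L powr \<alpha> * cosine_series c t = x powr \<alpha>"
    using cosine_series_cheb_coeff[OF \<alpha> t] x L by (simp add: c_def powr_divide)
  moreover have "cheb_approx \<alpha> L m x = L powr \<alpha> * (c 0 / 2 + (\<Sum>n<m. c (Suc n) * cos (real (Suc n) * t)))"
  proof -
    have "(\<Sum>k=1..m. cheb_coeff \<alpha> L k * cheb_T L k x) = (\<Sum>n<m. cheb_coeff \<alpha> L (Suc n) * cheb_T L (Suc n) x)"
      by (rule sum.reindex_bij_witness[of _ Suc "\<lambda>k. k - 1"]) auto
    then show ?thesis
      unfolding cheb_approx_def
      by (simp add: cheb_T_def t_def[symmetric] cheb_coeff_scale[of \<alpha> L] c_def[symmetric] sum_distrib_left distrib_left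
          mult.assoc del: of_nat_Suc)
  qed
  moreover have "cosine_series c t = c 0 / 2 + ((\<Sum>n. c (Suc (n + m)) * cos (real (Suc (n + m)) * t))
      + (\<Sum>n<m. c (Suc n) * cos (real (Suc n) * t)))"
    unfolding cosine_series_def
    by (subst suminf_split_initial_segment[OF cosine_series_summable[OF sm], of _ m]) simp
  ultimately have diff: "cheb_approx \<alpha> L m x - x powr \<alpha>
      = - (L powr \<alpha> * (\<Sum>n. c (Suc (n + m)) * cos (real (Suc (n + m)) * t)))"
    by (simp add: algebra_simps)
  have rec: "c (Suc k) * (\<alpha> + real k + 1) = c k * (\<alpha> - real k)" for k
    unfolding c_def using \<alpha> by (intro cheb_coeff_rec)
  have "\<bar>\<Sum>n. c (Suc (n + m)) * cos (real (Suc (n + m)) * t)\<bar> \<le> (\<Sum>n. \<bar>c (Suc m + n)\<bar>)"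
  proof -
    have sm': "summable (\<lambda>n. \<bar>c (Suc m + n)\<bar>)"
      by (rule cheb_recurrence_tail_summable[OF \<alpha>(1) m rec])
    have le: "norm (c (Suc (n + m)) * cos (real (Suc (n + m)) * t)) \<le> \<bar>c (Suc m + n)\<bar>" for n
      using norm_mult_trig_le(1)[of "c (Suc (n + m))" "real (Suc (n + m)) * t"] by (simp add: add.commute)
    have "norm (\<Sum>n. c (Suc (n + m)) * cos (real (Suc (n + m)) * t)) \<le> (\<Sum>n. \<bar>c (Suc m + n)\<bar>)"
      by (rule norm_suminf_le[OF le sm'])
    then show ?thesis by simp
  qed
  also have "\<dots> \<le> \<bar>c m\<bar> * (real m - \<alpha>) / (2 * \<alpha>)"
    by (rule cheb_recurrence_tail_le[OF \<alpha>(1) m rec])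
  finally have "L powr \<alpha> * \<bar>\<Sum>n. c (Suc (n + m)) * cos (real (Suc (n + m)) * t)\<bar>
      \<le> L powr \<alpha> * (\<bar>c m\<bar> * (real m - \<alpha>) / (2 * \<alpha>))"
    by (intro mult_left_mono) auto
  then show ?thesis
    by (simp add: diff abs_mult cheb_coeff_scale[of \<alpha> L m] c_def)
qed

section \<open>Gamma inequalities and the size of the coefficients\<close>

text \<open>An inequality form of the reflection formula: \<open>b\<close> and \<open>1 - b\<close>
  have midpoint \<open>1 / 2\<close>, where \<open>Gamma\<close> is \<open>sqrt pi\<close>, and
  \<open>ln \<circ> Gamma\<close> is convex.\<close>

lemma pi_le_Gamma_mult_Gamma:
  fixes b :: real
  assumes "0 < b" "b < 1"
  shows "pi \<le> Gamma b * Gamma (1 - b)"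
proof -
  have pos: "Gamma b > 0" "Gamma (1 - b) > 0"
    using assms by (auto intro: Gamma_real_pos)
  have "(ln \<circ> Gamma) ((1 - 1/2) *\<^sub>R b + (1/2) *\<^sub>R (1 - b)) \<le> (1 - 1/2) * (ln \<circ> Gamma) b + 1/2 * (ln \<circ> Gamma) (1 - b)"
    using assms by (intro convex_onD[OF log_convex_Gamma_real]) auto
  then have "ln (sqrt pi) \<le> (ln (Gamma b) + ln (Gamma (1 - b))) / 2"
    by (simp add: Gamma_one_half_real field_simps)
  then have "ln pi \<le> ln (Gamma b * Gamma (1 - b))"
    using pos by (simp add: ln_sqrt ln_mult)
  then show ?thesis
    using pos by (simp add: ln_le_cancel_iff)
qed

text \<open>By convexity the mean slope of \<open>ln \<circ> Gamma\<close> on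
  \<open>{z + 1..z + 1 + h}\<close> is at least that on \<open>{z..z + 1}\<close>, which is
  \<open>ln z\<close>.\<close>

lemma Gamma_shift_ge:
  fixes z :: real
  assumes "z > 0" "h > 0"
  shows "z powr h * Gamma (z + 1) \<le> Gamma (z + 1 + h)"
proof -
  \<comment> \<open>The weight that places \<open>z + 1\<close> between \<open>z\<close> and
    \<open>z + 1 + h\<close>.\<close>
  define u where "u = 1 / (1 + h)"
  have u: "0 < u" "u < 1" "u * (1 + h) = 1"
    using assms by (auto simp: u_def)
  have pos: "Gamma z > 0" "Gamma (z + 1) > 0" "Gamma (z + 1 + h) > 0"
    using assms by (auto intro: Gamma_real_pos)
  have "z \<notin> \<int>\<^sub>\<le>\<^sub>0"
    using assms nonpos_Ints_nonpos[of z] by auto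
  then have g1: "Gamma (z + 1) = z * Gamma z"
    by (rule Gamma_plus1)
  have "(ln \<circ> Gamma) ((1 - u) *\<^sub>R z + u *\<^sub>R (z + 1 + h)) \<le> (1 - u) * (ln \<circ> Gamma) z + u * (ln \<circ> Gamma) (z + 1 + h)"
    using assms u by (intro convex_onD[OF log_convex_Gamma_real]) auto
  moreover have "(1 - u) *\<^sub>R z + u *\<^sub>R (z + 1 + h) = z + 1"
    using u(3) by (simp add: algebra_simps)
  ultimately have "ln (Gamma (z + 1)) \<le> (1 - u) * ln (Gamma z) + u * ln (Gamma (z + 1 + h))"
    by simp
  then have "(1 + h) * ln (Gamma (z + 1)) \<le> (1 + h) * ((1 - u) * ln (Gamma z) + u * ln (Gamma (z + 1 + h)))"
    using assms by (intro mult_left_mono) auto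
  also have "\<dots> = (1 + h) * ln (Gamma z) - (u * (1 + h)) * ln (Gamma z) + (u * (1 + h)) * ln (Gamma (z + 1 + h))"
    by (simp add: algebra_simps)
  finally have "(1 + h) * ln (Gamma (z + 1)) \<le> h * ln (Gamma z) + ln (Gamma (z + 1 + h))"
    unfolding u(3) by (simp add: algebra_simps)
  moreover have "ln (Gamma (z + 1)) = ln z + ln (Gamma z)"
    using assms pos(1) by (simp only: g1 ln_mult_pos)
  ultimately have "h * ln z + ln (Gamma (z + 1)) \<le> ln (Gamma (z + 1 + h))"
    by (simp add: algebra_simps)
  then have "exp (h * ln z + ln (Gamma (z + 1))) \<le> exp (ln (Gamma (z + 1 + h)))"
    by simp
  then show ?thesis
    unfolding exp_add exp_ln[OF pos(2)] exp_ln[OF pos(3)] using assms by (simp add: powr_def)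
qed

text \<open>Up to \<open>m0\<close>, the ceiling of \<alpha>, all factors are positive and the
  product is \<open>Gamma (\<alpha> + 1) / Gamma b\<close> with \<open>b\<close> in the open unit
  interval; the reflection inequality moves \<open>Gamma b\<close> into the numerator. Beyond
  \<open>m0\<close> both sides gain the factor \<open>n - \<alpha>\<close> at each step.\<close>

lemma abs_falling_factorial_le:
  assumes \<alpha>: "\<alpha> > 0" "\<alpha> \<notin> \<int>" and m: "real m > \<alpha>"
  shows "\<bar>falling_factorial \<alpha> m\<bar> \<le> Gamma (\<alpha> + 1) * Gamma (real m - \<alpha>) / pi"
proof -
  define m0 where "m0 = nat \<lceil>\<alpha>\<rceil>"
  have m0: "real m0 = of_int \<lceil>\<alpha>\<rceil>"
    using \<alpha> by (simp add: m0_def)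
  then have ge: "\<alpha> \<le> real m0" and lt: "real m0 < \<alpha> + 1"
    by linarith+
  have "\<alpha> \<noteq> real m0"
    using \<alpha>(2) by auto
  then have gt: "\<alpha> < real m0"
    using ge by simp
  have "m0 \<le> m"
    using lt m by linarith
  then show ?thesis
  proof (induction m rule: dec_induct)
    case base
    define b where "b = \<alpha> + 1 - real m0"
    have b: "0 < b" "b < 1"
      using gt lt by (auto simp: b_def)
    have pos: "Gamma b > 0" "Gamma (\<alpha> + 1) > 0"
      using b \<alpha> by (auto intro: Gamma_real_pos)
    have "b \<notin> \<int>\<^sub>\<le>\<^sub>0"
      using b nonpos_Ints_nonpos[of b] by auto
    then have "falling_factorial \<alpha> m0 = Gamma (\<alpha> + 1) / Gamma b"
      by (simp add: falling_factorial_pochhammer pochhammer_Gamma b_def algebra_simps)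
    moreover have "1 / Gamma b \<le> Gamma (1 - b) / pi"
      using pi_le_Gamma_mult_Gamma[OF b] pos by (simp add: field_simps)
    then have "Gamma (\<alpha> + 1) * (1 / Gamma b) \<le> Gamma (\<alpha> + 1) * (Gamma (1 - b) / pi)"
      using pos by (intro mult_left_mono) auto
    moreover have "1 - b = real m0 - \<alpha>"
      by (simp add: b_def)
    ultimately show ?case
      using pos by simp
  next
    case (step n)
    have n: "real n - \<alpha> > 0"
      using step.hyps gt by linarith
    then have "real n - \<alpha> \<notin> \<int>\<^sub>\<le>\<^sub>0"
      using nonpos_Ints_nonpos[of "real n - \<alpha>"] by auto
    then have eq1: "Gamma (real (Suc n) - \<alpha>) = (real n - \<alpha>) * Gamma (real n - \<alpha>)"
      using Gamma_plus1[of "real n - \<alpha>"] by (simp add: algebra_simps)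
    have eq2: "\<bar>falling_factorial \<alpha> (Suc n)\<bar> = \<bar>falling_factorial \<alpha> n\<bar> * (real n - \<alpha>)"
      using n by (simp add: falling_factorial_Suc abs_mult)
    have "\<bar>falling_factorial \<alpha> n\<bar> * (real n - \<alpha>) \<le> (Gamma (\<alpha> + 1) * Gamma (real n - \<alpha>) / pi) * (real n - \<alpha>)"
      using step.IH n by (intro mult_right_mono) auto
    then show ?case
      unfolding eq1 eq2 by (simp add: mult_ac)
  qed
qed

text \<open>With \<open>z = m - \<alpha>\<close>, the factor \<open>m - \<alpha>\<close> raises
  \<open>Gamma z\<close> to \<open>Gamma (z + 1)\<close>, while the denominator contributes
  \<open>Gamma (z + 1 + 2 * \<alpha>)\<close>. The shift by \<open>2 * \<alpha>\<close> between them
  is the decay exponent.\<close>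

lemma cheb_coeff_tail_le:
  assumes \<alpha>: "\<alpha> > 0" "\<alpha> \<notin> \<int>" and m: "real m > \<alpha>"
  shows "\<bar>cheb_coeff \<alpha> L m\<bar> * (real m - \<alpha>) / (2 * \<alpha>)
           \<le> L powr \<alpha> * (Gamma (\<alpha> + 1/2) * Gamma \<alpha> / pi powr (3/2)) * (real m - \<alpha>) powr (- 2 * \<alpha>)"
proof -
  define z where "z = real m - \<alpha>"
  have z: "z > 0" using m by (simp add: z_def)
  have notin: "x \<notin> \<int>\<^sub>\<le>\<^sub>0" if "x > 0" for x :: real
    using that nonpos_Ints_nonpos[of x] by auto
  have pos: "Gamma (\<alpha> + 1/2) > 0" "Gamma \<alpha> > 0" "Gamma (\<alpha> + 1) > 0" "Gamma z > 0" "Gamma (z + 1) > 0"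
    "Gamma (z + 1 + 2 * \<alpha>) > 0"
    using \<alpha> z by (auto intro!: Gamma_real_pos)
  have G\<alpha>: "Gamma (\<alpha> + 1) = \<alpha> * Gamma \<alpha>" and Gz: "Gamma (z + 1) = z * Gamma z"
    using \<alpha> z by (auto intro!: Gamma_plus1 notin)
  have eq: "z + 1 + 2 * \<alpha> = \<alpha> + 1 + real m"
    by (simp add: z_def)
  have "\<alpha> + 1 \<notin> \<int>\<^sub>\<le>\<^sub>0"
    using \<alpha> by (intro notin) auto
  then have ff: "falling_factorial (\<alpha> + real m) m = Gamma (z + 1 + 2 * \<alpha>) / Gamma (\<alpha> + 1)"
    unfolding eq falling_factorial_shift by (rule pochhammer_Gamma)
  have "\<bar>falling_factorial \<alpha> m\<bar> * z \<le> (Gamma (\<alpha> + 1) * Gamma z / pi) * z"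
    using abs_falling_factorial_le[OF assms] z by (intro mult_right_mono) (auto simp: z_def)
  also have "\<dots> = Gamma (\<alpha> + 1) / pi * Gamma (z + 1)"
    by (simp add: Gz)
  also have "\<dots> \<le> Gamma (\<alpha> + 1) / pi * (Gamma (z + 1 + 2 * \<alpha>) * z powr (- 2 * \<alpha>))"
  proof -
    have "Gamma (z + 1) \<le> Gamma (z + 1 + 2 * \<alpha>) * z powr (- 2 * \<alpha>)"
      using Gamma_shift_ge[OF z, of "2 * \<alpha>"] \<alpha> z by (simp add: powr_minus field_simps)
    then show ?thesis
      using pos by (intro mult_left_mono) auto
  qed
  finally have "(2 * L powr \<alpha> * Gamma (\<alpha> + 1/2) / (sqrt pi * Gamma (\<alpha> + 1) * falling_factorial (\<alpha> + real m) m) / (2 * \<alpha>)) *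
        (\<bar>falling_factorial \<alpha> m\<bar> * z)
      \<le> (2 * L powr \<alpha> * Gamma (\<alpha> + 1/2) / (sqrt pi * Gamma (\<alpha> + 1) * falling_factorial (\<alpha> + real m) m) / (2 * \<alpha>)) *
        (Gamma (\<alpha> + 1) / pi * (Gamma (z + 1 + 2 * \<alpha>) * z powr (- 2 * \<alpha>)))"
    using pos \<alpha> unfolding ff by (intro mult_left_mono) auto
  also have "\<dots> = L powr \<alpha> * (Gamma (\<alpha> + 1/2) * Gamma \<alpha> / (pi * sqrt pi)) * z powr (- 2 * \<alpha>)"
    using pos \<alpha> unfolding ff G\<alpha> by (simp add: field_simps)
  also have "pi * sqrt pi = pi powr (3/2)"
  proof -
    have "pi powr (3/2) = pi powr (1 + 1/2)" by simp
    also have "\<dots> = pi * sqrt pi" by (simp only: powr_add powr_half_sqrt[OF pi_ge_zero] powr_one pi_ge_zero)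
    finally show ?thesis by simp
  qed
  also have "(2 * L powr \<alpha> * Gamma (\<alpha> + 1/2) / (sqrt pi * Gamma (\<alpha> + 1) * falling_factorial (\<alpha> + real m) m) / (2 * \<alpha>)) *
        (\<bar>falling_factorial \<alpha> m\<bar> * z) = \<bar>cheb_coeff \<alpha> L m\<bar> * z / (2 * \<alpha>)"
    using pos \<alpha> unfolding ff by (simp add: cheb_coeff_def ff abs_mult abs_divide)
  finally show ?thesis by (simp add: z_def)
qed

text \<open>The tail bound solved for \<open>m\<close>, with the precision \<open>C\<close> left
  free so that both formulas for \<open>m\<close> are instances.\<close>

lemma cheb_approx_error_powr:
  assumes \<alpha>: "\<alpha> > 0" "\<alpha> \<notin> \<int>" and x: "0 \<le> x" "x \<le> L" and L: "L > 0" and C: "C > 0"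
    and m: "real m \<ge> \<alpha> + (C * (Gamma (\<alpha> + 1/2) * Gamma \<alpha> / pi powr (3/2))) powr (1 / (2 * \<alpha>))"
  shows "\<bar>cheb_approx \<alpha> L m x - x powr \<alpha>\<bar> \<le> L powr \<alpha> / C"
proof -
  define D where "D = Gamma (\<alpha> + 1/2) * Gamma \<alpha> / pi powr (3/2)"
  have D: "D > 0"
    using \<alpha> by (auto simp: D_def intro!: divide_pos_pos mult_pos_pos Gamma_real_pos)
  have low: "0 < (C * D) powr (1 / (2 * \<alpha>))" "(C * D) powr (1 / (2 * \<alpha>)) \<le> real m - \<alpha>"
    using C D m by (auto simp: D_def)
  then have gt: "real m > \<alpha>" by linarith
  have "(real m - \<alpha>) powr (- 2 * \<alpha>) \<le> ((C * D) powr (1 / (2 * \<alpha>))) powr (- 2 * \<alpha>)"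
    using low \<alpha> by (intro powr_mono2') auto
  also have "\<dots> = 1 / (C * D)"
    using \<alpha> C D by (simp add: powr_powr powr_minus_divide)
  finally have le: "(real m - \<alpha>) powr (- 2 * \<alpha>) \<le> 1 / (C * D)" .
  have "\<bar>cheb_approx \<alpha> L m x - x powr \<alpha>\<bar> \<le> \<bar>cheb_coeff \<alpha> L m\<bar> * (real m - \<alpha>) / (2 * \<alpha>)"
    using gt by (intro cheb_approx_error_le \<alpha> x L) auto
  also have "\<dots> \<le> L powr \<alpha> * D * (real m - \<alpha>) powr (- 2 * \<alpha>)"
    unfolding D_def by (rule cheb_coeff_tail_le[OF \<alpha> gt])
  also have "\<dots> \<le> L powr \<alpha> * D * (1 / (C * D))"
    using le D by (intro mult_left_mono) auto
  also have "\<dots> = L powr \<alpha> / C"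
    using D by simp
  finally show ?thesis .
qed

section \<open>The entropy estimate\<close>

lemma transpose_normalized_kernel_matrix:
  assumes "positive_kernel \<phi>"
  shows "transpose (normalized_kernel_matrix \<phi> x) = normalized_kernel_matrix \<phi> x"
  using assms by (simp add: vec_eq_iff transpose_def normalized_kernel_matrix_def positive_kernel_def mult.commute)

lemma normalized_kernel_matrix_psd:
  fixes x :: "'n::finite \<Rightarrow> 'x" and v :: "real^'n"
  assumes \<phi>: "positive_kernel \<phi>"
  shows "0 \<le> v \<bullet> (normalized_kernel_matrix \<phi> x *v v)"
proof -
  define n where "n = CARD('n)"
  \<comment> \<open>\<open>positive_kernel\<close> speaks of families indexed by initial segments of
    the naturals, so the matrix indices are enumerated.\<close>
  obtain h where h: "bij_betw h {..<n} (UNIV :: 'n set)"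
    unfolding n_def using ex_bij_betw_nat_finite[OF finite[of "UNIV :: 'n set"]] by (auto simp: atLeast0LessThan)
  define w where "w i = v $ i / sqrt (\<phi> (x i) (x i))" for i
  have "0 \<le> (\<Sum>i<n. \<Sum>j<n. w (h i) * w (h j) * \<phi> (x (h i)) (x (h j)))"
    using \<phi>[unfolded positive_kernel_def, THEN conjunct2, rule_format, where N = n and c = "\<lambda>i. w (h i)" and x = "\<lambda>i. x (h i)"] .
  also have "\<dots> = (\<Sum>i\<in>UNIV. \<Sum>j\<in>UNIV. w i * w j * \<phi> (x i) (x j))"
    using sum.reindex_bij_betw[OF h, of "\<lambda>i. \<Sum>j\<in>UNIV. w i * w j * \<phi> (x i) (x j)"]
      sum.reindex_bij_betw[OF h, of "\<lambda>j. w i * w j * \<phi> (x i) (x j)" for i] by simp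
  finally have "0 \<le> 1 / real n * (\<Sum>i\<in>UNIV. \<Sum>j\<in>UNIV. w i * w j * \<phi> (x i) (x j))"
    by simp
  also have "\<dots> = v \<bullet> (normalized_kernel_matrix \<phi> x *v v)"
    by (simp add: inner_vec_def matrix_vector_mult_def normalized_kernel_matrix_def w_def n_def
        real_sqrt_mult sum_distrib_left mult_ac)
  finally show ?thesis .
qed

lemma normalized_kernel_matrix_diag:
  fixes x :: "'n::finite \<Rightarrow> 'x"
  assumes "\<phi> (x i) (x i) > 0"
  shows "normalized_kernel_matrix \<phi> x $ i $ i = 1 / real CARD('n)"
  using assms by (simp add: normalized_kernel_matrix_def)

text \<open>On the logarithmic scale the claim is symmetric: each of \<open>T\<close> and
  \<open>t\<close> must be at least \<open>1 - 3 * \<epsilon>\<close> times the other. Approximation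
  and sampling cost one \<open>\<epsilon>\<close> each, and the third absorbs the second-order
  term.\<close>

lemma log_ratio_bound_of_deviation:
  fixes \<mu> :: "'n::finite \<Rightarrow> real"
  assumes \<epsilon>: "0 < \<epsilon>" "\<epsilon> < 1 / 3" and T: "T > 0"
    and abs_le: "\<bar>(\<Sum>j\<in>UNIV. \<mu> j) - T\<bar> \<le> \<epsilon> * T"
    and t: "\<bar>t - (\<Sum>j\<in>UNIV. \<mu> j)\<bar> \<le> \<epsilon> * ((1 + \<epsilon>) * T)"
  shows "t > 0" and "\<bar>log 2 T - log 2 t\<bar> \<le> \<bar>log 2 (1 - 3 * \<epsilon>)\<bar>"
proof -
  have "t \<ge> T - \<epsilon> * T - \<epsilon> * ((1 + \<epsilon>) * T)"
    using abs_le t by linarith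
  also have "T - \<epsilon> * T - \<epsilon> * ((1 + \<epsilon>) * T) = (1 - 2 * \<epsilon> - \<epsilon> * \<epsilon>) * T"
    by (simp add: algebra_simps)
  finally have "(1 - 2 * \<epsilon> - \<epsilon> * \<epsilon>) * T \<le> t" .
  moreover have "(1 - 3 * \<epsilon>) * T \<le> (1 - 2 * \<epsilon> - \<epsilon> * \<epsilon>) * T"
    using \<epsilon> T mult_left_mono[of \<epsilon> 1 \<epsilon>] by (intro mult_right_mono) auto
  ultimately have lo: "(1 - 3 * \<epsilon>) * T \<le> t" by linarith
  have e: "0 < 1 - 3 * \<epsilon>" using \<epsilon> by simp
  then have "0 < (1 - 3 * \<epsilon>) * T" using T by simp
  with lo show t0: "t > 0" by linarith
  have "t \<le> T + \<epsilon> * T + \<epsilon> * ((1 + \<epsilon>) * T)"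
    using abs_le t by linarith
  also have "\<dots> = (1 + \<epsilon>)\<^sup>2 * T"
    by (simp add: power2_eq_square algebra_simps)
  finally have "(1 - 3 * \<epsilon>) * t \<le> (1 - 3 * \<epsilon>) * ((1 + \<epsilon>)\<^sup>2 * T)"
    using e by (intro mult_left_mono) auto
  also have "\<dots> = T - (\<epsilon> + 5 * \<epsilon>\<^sup>2 + 3 * \<epsilon> ^ 3) * T"
    by (simp add: power2_eq_square power3_eq_cube algebra_simps)
  also have "\<dots> \<le> T"
    using \<epsilon> T by simp
  finally have hi: "(1 - 3 * \<epsilon>) * t \<le> T" .
  have "log 2 (1 - 3 * \<epsilon>) + log 2 T \<le> log 2 t"
    using lo e T t0 by (simp add: log_mult_pos[symmetric])
  moreover have "log 2 (1 - 3 * \<epsilon>) + log 2 t \<le> log 2 T"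
    using hi e T t0 by (simp add: log_mult_pos[symmetric])
  moreover have "log 2 (1 - 3 * \<epsilon>) \<le> 0"
    using e \<epsilon> by simp
  ultimately show "\<bar>log 2 T - log 2 t\<bar> \<le> \<bar>log 2 (1 - 3 * \<epsilon>)\<bar>"
    by linarith
qed

lemma cheb_approx_spectral_error:
  fixes d :: "'n::finite \<Rightarrow> real"
  assumes \<alpha>: "\<alpha> > 0" "\<alpha> \<notin> \<int>" and \<epsilon>: "\<epsilon> > 0"
    and L: "L = Max (range d)" "L > 0" and l: "l = Min (range d)" "l \<ge> 0"
    and m_pos: "l > 0 \<Longrightarrow> real m \<ge> \<alpha> + sqrt (L / l) *
            (Gamma (\<alpha> + 1/2) * Gamma \<alpha> / (\<epsilon> * pi powr (3/2))) powr (1 / (2 * \<alpha>))"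
    and m_0: "l = 0 \<Longrightarrow> real m \<ge> \<alpha> +
            (real CARD('n) * Gamma (\<alpha> + 1/2) * Gamma \<alpha> / (\<epsilon> * pi powr (3/2))) powr (1 / (2 * \<alpha>))"
  shows "(\<Sum>i\<in>UNIV. \<bar>cheb_approx \<alpha> L m (d i) - d i powr \<alpha>\<bar>) \<le> \<epsilon> * (\<Sum>i\<in>UNIV. d i powr \<alpha>)"
proof -
  have dL: "d i \<le> L" and ld: "l \<le> d i" for i
    by (auto simp: L l)
  have d0: "0 \<le> d i" for i
    using l(2) ld[of i] by simp
  define D where "D = Gamma (\<alpha> + 1/2) * Gamma \<alpha> / pi powr (3/2)"
  have D: "D > 0"
    using \<alpha> by (auto simp: D_def intro!: divide_pos_pos mult_pos_pos Gamma_real_pos)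
  show ?thesis
  proof (cases "l > 0")
    case True
    define C where "C = (L / l) powr \<alpha> / \<epsilon>"
    have C: "C > 0"
      using True L(2) \<epsilon> by (simp add: C_def)
    have "(C * D) powr (1 / (2 * \<alpha>)) = ((L / l) powr \<alpha>) powr (1 / (2 * \<alpha>)) * (D / \<epsilon>) powr (1 / (2 * \<alpha>))"
      using True L(2) \<epsilon> D by (simp add: C_def powr_mult[symmetric])
    also have "((L / l) powr \<alpha>) powr (1 / (2 * \<alpha>)) = sqrt (L / l)"
      using True L(2) \<alpha> by (simp add: powr_powr powr_half_sqrt)
    finally have m: "real m \<ge> \<alpha> + (C * D) powr (1 / (2 * \<alpha>))"
      using m_pos[OF True] by (simp add: D_def mult.commute)
    have "\<bar>cheb_approx \<alpha> L m (d i) - d i powr \<alpha>\<bar> \<le> \<epsilon> * d i powr \<alpha>" for i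
    proof -
      have "\<bar>cheb_approx \<alpha> L m (d i) - d i powr \<alpha>\<bar> \<le> L powr \<alpha> / C"
        using m unfolding D_def by (intro cheb_approx_error_powr \<alpha> d0 dL L(2) C)
      also have "\<dots> = \<epsilon> * l powr \<alpha>"
        using True L(2) \<epsilon> by (simp add: C_def powr_divide)
      also have "\<dots> \<le> \<epsilon> * d i powr \<alpha>"
        using \<epsilon> \<alpha> True ld by (intro mult_left_mono powr_mono2) auto
      finally show ?thesis .
    qed
    then show ?thesis
      unfolding sum_distrib_left by (intro sum_mono)
  next
    case False
    then have l0: "l = 0" using l(2) by simp
    define C where "C = real CARD('n) / \<epsilon>"
    have C: "C > 0"
      using \<epsilon> by (simp add: C_def)
    have m: "real m \<ge> \<alpha> + (C * D) powr (1 / (2 * \<alpha>))"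
      using m_0[OF l0] by (simp add: D_def C_def mult_ac)
    have "L \<in> range d"
      unfolding L by (rule Max_in) auto
    then obtain i0 where "d i0 = L" by blast
    have "(\<Sum>i\<in>UNIV. \<bar>cheb_approx \<alpha> L m (d i) - d i powr \<alpha>\<bar>) \<le> (\<Sum>i\<in>(UNIV :: 'n set). L powr \<alpha> / C)"
      using m unfolding D_def by (intro sum_mono cheb_approx_error_powr \<alpha> d0 dL L(2) C)
    also have "\<dots> = \<epsilon> * d i0 powr \<alpha>"
      using \<open>d i0 = L\<close> by (simp add: C_def)
    also have "\<dots> \<le> \<epsilon> * (\<Sum>i\<in>UNIV. d i powr \<alpha>)"
      using \<epsilon> by (intro mult_left_mono member_le_sum) auto
    finally show ?thesis .
  qed
qed

theorem theorem3:
  fixes \<phi> :: "'x \<Rightarrow> 'x \<Rightarrow> real"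
    and x :: "'n::finite \<Rightarrow> 'x"
    and G :: "real^'n^'n"
    and \<alpha> \<epsilon> \<delta> \<kappa> :: real
    and s m :: nat
    and M :: "'a measure"
    and g :: "nat \<Rightarrow> 'a \<Rightarrow> real^'n"
  assumes "infinitely_divisible_kernel \<phi>"
    and "\<And>i. \<phi> (x i) (x i) > 0"
    and "G = normalized_kernel_matrix \<phi> x"
    and "\<alpha> > 0" and "\<alpha> \<notin> \<int>"
    and "0 < \<epsilon>" and "\<epsilon> < 1/3"
    and "0 < \<delta>" and "\<delta> < 1"
    and "s = nat \<lceil>8 * ln (2 / \<delta>) / \<epsilon>\<^sup>2\<rceil>"
    and "lambda_min G > 0 \<Longrightarrow> \<kappa> = lambda_max G / lambda_min G"
    and "lambda_min G > 0 \<Longrightarrow>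
      m = nat \<lceil>\<alpha> + sqrt \<kappa> *
            (Gamma (\<alpha> + 1/2) * Gamma \<alpha> / (\<epsilon> * pi powr (3/2))) powr (1 / (2 * \<alpha>))\<rceil>"
    and "lambda_min G = 0 \<Longrightarrow>
      m = nat \<lceil>\<alpha> +
            (real CARD('n) * Gamma (\<alpha> + 1/2) * Gamma \<alpha> / (\<epsilon> * pi powr (3/2))) powr (1 / (2 * \<alpha>))\<rceil>"
    and "prob_space M"
    and "prob_space.indep_vars M (\<lambda>_. borel) g {1..s}"
    and "\<And>i. i \<in> {1..s} \<Longrightarrow> std_gaussian_vector M (g i)"
  shows "measure M {\<omega> \<in> space M.
           trace_estimate \<alpha> m s G (\<lambda>i. g i \<omega>) > 0 \<and>
           \<bar>renyi_entropy \<alpha> G - entropy_estimate \<alpha> m s G (\<lambda>i. g i \<omega>)\<bar>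
             \<le> \<bar>1 / (1 - \<alpha>) * log 2 (1 - 3 * \<epsilon>)\<bar>} \<ge> 1 - \<delta>"
proof -
  note \<alpha> = assms(4,5) and \<epsilon> = assms(6,7) and \<delta> = assms(8,9) and s = assms(10)
    and ind = assms(15) and gauss = assms(16)
  interpret prob_space M by (rule assms(14))
  have \<phi>: "positive_kernel \<phi>"
    using assms(1) by (simp add: infinitely_divisible_kernel_def)
  obtain q d where q: "orthonormal_family q" and eig: "\<And>i. G *v q i = d i *\<^sub>R q i"
    using symmetric_matrix_diagonalization[of G] transpose_normalized_kernel_matrix[OF \<phi>, of x] assms(3) by metis
  have d0: "0 \<le> d i" for i
  proof -
    have "q i \<bullet> q i = 1"
      using q by (simp add: orthonormal_family_def)
    then show ?thesis
      using normalized_kernel_matrix_psd[OF \<phi>, of "q i" x] eig[of i] by (simp add: assms(3))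
  qed
  have eigs: "eigenvalues G = image_mset d (mset_set UNIV)"
    by (rule eigenvalues_eq_image[OF q eig])
  define L where "L = Max (range d)"
  define l where "l = Min (range d)"
  have L: "lambda_max G = L" and l: "lambda_min G = l"
    by (simp_all add: lambda_max_def lambda_min_def eigs L_def l_def)
  have dL: "d i \<le> L" for i by (simp add: L_def)
  have l0: "l \<ge> 0" using d0 by (simp add: l_def)
  \<comment> \<open>Nonnegative eigenvalues with maximum 0 would make the quadratic form vanish,
    against the positive diagonal of \<open>G\<close>. Positivity of \<open>L\<close> is also what
    makes \<open>cheb_approx_poly\<close> well defined.\<close>
  have "L > 0"
  proof (rule ccontr)
    assume "\<not> L > 0"
    then have "d i = 0" for i
      using dL[of i] d0[of i] by simp
    then have "axis i 1 \<bullet> (G *v axis i 1) = 0" for i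
      by (simp add: quadratic_form_eigenbasis[OF q eig])
    moreover have "axis i 1 \<bullet> (G *v axis i 1) = G $ i $ i" for i
      by (simp add: inner_axis' matrix_vector_mul_component inner_axis)
    ultimately have "G $ i $ i = 0" for i by simp
    moreover have "G $ i $ i \<noteq> 0" for i
      using normalized_kernel_matrix_diag[of \<phi> x i] assms(2,3) by simp
    ultimately show False by blast
  qed
  define T where "T = (\<Sum>i\<in>UNIV. d i powr \<alpha>)"
  have "T > 0"
  proof -
    have "L \<in> range d"
      unfolding L_def by (rule Max_in) auto
    then obtain i where "d i = L" by blast
    then have "0 < d i powr \<alpha>" using \<open>L > 0\<close> by simp
    also have "\<dots> \<le> T"
      unfolding T_def by (rule member_le_sum) auto
    finally show ?thesis .
  qed
  have renyi: "renyi_entropy \<alpha> G = 1 / (1 - \<alpha>) * log 2 T"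
    by (simp add: renyi_entropy_def eigs T_def sum_unfold_sum_mset image_mset.compositionality comp_def)
  define \<mu> where "\<mu> i = cheb_approx \<alpha> L m (d i)" for i
  have err: "(\<Sum>i\<in>UNIV. \<bar>\<mu> i - d i powr \<alpha>\<bar>) \<le> \<epsilon> * T"
    unfolding \<mu>_def T_def
  proof (rule cheb_approx_spectral_error[OF \<alpha> \<epsilon>(1) L_def \<open>L > 0\<close> l_def l0])
    show "real m \<ge> \<alpha> + sqrt (L / l) *
            (Gamma (\<alpha> + 1/2) * Gamma \<alpha> / (\<epsilon> * pi powr (3/2))) powr (1 / (2 * \<alpha>))" if "l > 0"
      using assms(11,12) that unfolding L l by (simp add: real_nat_ceiling_ge)
    show "real m \<ge> \<alpha> +
            (real CARD('n) * Gamma (\<alpha> + 1/2) * Gamma \<alpha> / (\<epsilon> * pi powr (3/2))) powr (1 / (2 * \<alpha>))" if "l = 0"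
      using assms(13) that unfolding l by (simp add: real_nat_ceiling_ge)
  qed
  have sum_\<mu>: "\<bar>(\<Sum>i\<in>UNIV. \<mu> i) - T\<bar> \<le> \<epsilon> * T"
    using sum_abs[of "\<lambda>i. \<mu> i - d i powr \<alpha>" UNIV] err by (simp add: sum_subtractf T_def)
  have abs_\<mu>: "(\<Sum>i\<in>UNIV. \<bar>\<mu> i\<bar>) \<le> (1 + \<epsilon>) * T"
  proof -
    have "(\<Sum>i\<in>UNIV. \<bar>\<mu> i\<bar>) \<le> (\<Sum>i\<in>UNIV. d i powr \<alpha> + \<bar>\<mu> i - d i powr \<alpha>\<bar>)"
      by (intro sum_mono) (smt (verit) powr_ge_zero)
    also have "\<dots> \<le> (1 + \<epsilon>) * T"
      using err by (simp add: sum.distrib T_def[symmetric] algebra_simps)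
    finally show ?thesis .
  qed
  have "8 * ln (2 / \<delta>) / \<epsilon>\<^sup>2 > 0"
    using \<delta> \<epsilon> by simp
  then have s_ge: "real s \<ge> 8 * ln (2 / \<delta>) / \<epsilon>\<^sup>2" and s0: "s > 0"
    unfolding s by (auto simp: real_nat_ceiling_ge)
  \<comment> \<open>Up to rounding, \<open>s\<close> is the sample count at which the two-sided tail
    bound equals \<open>\<delta>\<close>.\<close>
  have tail: "2 * exp (- real s * \<epsilon>\<^sup>2 / 8) \<le> \<delta>"
  proof -
    have "ln (2 / \<delta>) \<le> real s * \<epsilon>\<^sup>2 / 8"
      using s_ge \<epsilon> by (simp add: field_simps)
    then have "exp (- real s * \<epsilon>\<^sup>2 / 8) \<le> exp (- ln (2 / \<delta>))"
      by simp
    also have "\<dots> = \<delta> / 2"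
      using \<delta> by (simp add: exp_minus)
    finally show ?thesis by simp
  qed
  define P where "P = matrix_poly (cheb_approx_poly \<alpha> L m) G"
  \<comment> \<open>Every \<open>d i\<close> lies in \<open>{0..L}\<close>, where the polynomial and
    the cosine formula agree.\<close>
  have P_eig: "P *v q i = \<mu> i *\<^sub>R q i" for i
    using matrix_poly_eigenvector[OF eig] \<open>L > 0\<close> d0 dL
    by (simp add: P_def \<mu>_def poly_cheb_approx_poly)
  define t where "t \<omega> = trace_estimate \<alpha> m s G (\<lambda>i. g i \<omega>)" for \<omega>
  have t_eq: "t \<omega> = 1 / real s * (\<Sum>i=1..s. \<Sum>j\<in>UNIV. \<mu> j * (q j \<bullet> g i \<omega>)\<^sup>2)" for \<omega>
    unfolding t_def trace_estimate_def L P_def[symmetric] quadratic_form_eigenbasis[OF q P_eig] ..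
  have dev: "\<bar>t \<omega> - (\<Sum>j\<in>UNIV. \<mu> j)\<bar> \<le> \<epsilon> * ((1 + \<epsilon>) * T)"
    if "\<bar>\<Sum>i\<in>{1..s}. \<Sum>j\<in>UNIV. \<mu> j * ((q j \<bullet> g i \<omega>)\<^sup>2 - 1)\<bar> \<le> real (card {1..s}) * \<epsilon> * ((1 + \<epsilon>) * T)" for \<omega>
  proof -
    have "(\<Sum>i\<in>{1..s}. \<Sum>j\<in>UNIV. \<mu> j * ((q j \<bullet> g i \<omega>)\<^sup>2 - 1)) = real s * (t \<omega> - (\<Sum>j\<in>UNIV. \<mu> j))"
      using s0 by (simp add: t_eq right_diff_distrib sum_subtractf)
    then have "real s * \<bar>t \<omega> - (\<Sum>j\<in>UNIV. \<mu> j)\<bar> \<le> real s * (\<epsilon> * ((1 + \<epsilon>) * T))"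
      using that by (simp add: abs_mult mult.assoc)
    then show ?thesis
      using s0 by simp
  qed
  have g_meas [measurable]: "g i \<in> borel_measurable M" if "i \<in> {1..s}" for i
    using ind that by (auto simp: indep_vars_def)
  have t_meas [measurable]: "t \<in> borel_measurable M"
    unfolding t_eq[abs_def] by measurable
  have "1 - \<delta> \<le> 1 - 2 * exp (- real (card {1..s}) * \<epsilon>\<^sup>2 / 8)"
    using tail by simp
  also have "\<dots> \<le> prob {\<omega>\<in>space M. \<bar>\<Sum>i\<in>{1..s}. \<Sum>j\<in>UNIV. \<mu> j * ((q j \<bullet> g i \<omega>)\<^sup>2 - 1)\<bar>
      \<le> real (card {1..s}) * \<epsilon> * ((1 + \<epsilon>) * T)}"
    using \<epsilon> \<open>T > 0\<close> by (intro gaussian_quadratic_form_concentration ind gauss q abs_\<mu>) auto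
  also have "\<dots> \<le> prob {\<omega>\<in>space M. t \<omega> > 0 \<and>
      \<bar>1 / (1 - \<alpha>) * log 2 T - 1 / (1 - \<alpha>) * log 2 (t \<omega>)\<bar> \<le> \<bar>1 / (1 - \<alpha>) * log 2 (1 - 3 * \<epsilon>)\<bar>}"
  proof (rule finite_measure_mono)
    show "{\<omega>\<in>space M. t \<omega> > 0 \<and>
      \<bar>1 / (1 - \<alpha>) * log 2 T - 1 / (1 - \<alpha>) * log 2 (t \<omega>)\<bar> \<le> \<bar>1 / (1 - \<alpha>) * log 2 (1 - 3 * \<epsilon>)\<bar>} \<in> events"
      by measurable
    show "{\<omega>\<in>space M. \<bar>\<Sum>i\<in>{1..s}. \<Sum>j\<in>UNIV. \<mu> j * ((q j \<bullet> g i \<omega>)\<^sup>2 - 1)\<bar>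
        \<le> real (card {1..s}) * \<epsilon> * ((1 + \<epsilon>) * T)}
      \<subseteq> {\<omega>\<in>space M. t \<omega> > 0 \<and>
        \<bar>1 / (1 - \<alpha>) * log 2 T - 1 / (1 - \<alpha>) * log 2 (t \<omega>)\<bar> \<le> \<bar>1 / (1 - \<alpha>) * log 2 (1 - 3 * \<epsilon>)\<bar>}"
    proof (intro subsetI CollectI conjI; elim CollectE conjE)
      fix \<omega>
      assume "\<bar>\<Sum>i\<in>{1..s}. \<Sum>j\<in>UNIV. \<mu> j * ((q j \<bullet> g i \<omega>)\<^sup>2 - 1)\<bar>
        \<le> real (card {1..s}) * \<epsilon> * ((1 + \<epsilon>) * T)"
      note bounds = log_ratio_bound_of_deviation[OF \<epsilon> \<open>T > 0\<close> sum_\<mu> dev[OF this]]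
      show "t \<omega> > 0" by (rule bounds(1))
      \<comment> \<open>The absolute value of \<open>1 / (1 - \<alpha>)\<close> factors out on both
        sides, so the cases \<open>\<alpha> < 1\<close> and \<open>\<alpha> > 1\<close> need no
        separation.\<close>
      show "\<bar>1 / (1 - \<alpha>) * log 2 T - 1 / (1 - \<alpha>) * log 2 (t \<omega>)\<bar> \<le> \<bar>1 / (1 - \<alpha>) * log 2 (1 - 3 * \<epsilon>)\<bar>"
        unfolding right_diff_distrib[symmetric] abs_mult
        by (intro mult_left_mono bounds(2)) auto
    qed
  qed
  finally show ?thesis
    by (simp only: renyi entropy_estimate_def t_def)
qed

end
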